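(* Let $(M,g)$ be a $2$-Riemannian manifold of dimension $3$. Then $(M,g)$ is locally flat if and only if for every $p_0\in M$ there is a coordinate system $(O,\phi)$ around $p_0$ (an open set $O\subset\mathbb{R}^3$ and a diffeomorphism $\phi$ from $O$ onto an open neighborhood of $p_0$ in $M$) such that the system of first order PDE $$\sum_{1\leq \alpha<\beta\leq 3}\frac{\partial(f^\alpha,f^\beta)}{\partial(x^i,x^k)}\cdot\frac{\partial(f^\alpha,f^\beta)}{\partial(x^j,x^k)}=g_{ijk},\qquad i,j,k\in\{1,2,3\},$$ has a $C^\infty$ solution $f=(f^1,f^2,f^3):O\to\mathbb{R}^3$, where $(x^1,x^2,x^3)$ is the standard coordinate system of $\mathbb{R}^3$, $\frac{\partial(a,b)}{\partial(x^i,x^k)}=\frac{\partial a}{\partial x^i}\frac{\partial b}{\partial x^k}-\frac{\partial a}{\partial x^k}\frac{\partial b}{\partial x^i}$, and $g_{ijk}:O\to\mathbb{R}$ are the functions $$g_{ijk}(q)=g_{\phi(q)}\left(D\phi_q\left(\tfrac{\partial}{\partial x^i}\right),D\phi_q\left(\tfrac{\partial}{\partial x^j}\right)\Big/D\phi_q\left(\tfrac{\partial}{\partial x^k}\right)\right).$$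
   Context: Manifolds and maps are $C^\infty$; $\mathcal{X}(M)$ denotes the $C^\infty$ vector fields on $M$. A $2$-inner product on a real vector space $V$ is a map $g:V\times V\times V\to\mathbb{R}$, written $g(u,v/w)$, such that for all $u,u',v,w\in V$, $\alpha\in\mathbb{R}$: (1) $g(u,u/v)\ge 0$, and $g(u,u/v)=0$ iff $u,v$ are linearly dependent; (2) $g(u,u/v)=g(v,v/u)$; (3) $g(u,v/w)=g(v,u/w)$; (4) $g(\alpha u+u',v/w)=\alpha g(u,v/w)+g(u',v/w)$. A $2$-Riemannian metric on $M$ is an assignment $g$ of a $2$-inner product $g_p$ to each $T_pM$ such that $p\mapsto g_p(X(p),Y(p)/Z(p))$ is $C^\infty$ for all $X,Y,Z\in\mathcal{X}(M)$; then $(M,g)$ is a $2$-Riemannian manifold. A $2$-isometry between $2$-Riemannian manifolds $(M,g)$ and $(\overline M,\overline g)$ is a diffeomorphism $h:M\to\overline M$ with $\overline g_{h(p)}(Dh_p(u),Dh_p(v)/Dh_p(w))=g_p(u,v/w)$ for all $p\in M$, $u,v,w\in T_pM$. $(M,g)$ is locally $2$-isometric to $(\overline M,\overline g)$ if for every $p\in M$ there are an open neighborhood $U$ of $p$ in $M$ and an open set $\overline U\subset\overline M$ such that $(U,g)$ and $(\overline U,\overline g)$ are $2$-isometric (there is a $2$-isometry between them). $g^{st}$ is the $2$-Riemannian metric on $\mathbb{R}^n$ given by $g^{st}_p(u,v/w)=\langle u,v\rangle\langle w,w\rangle-\langle u,w\rangle\langle v,w\rangle$, with $\langle\cdot,\cdot\rangle$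 the Euclidean inner product. A $2$-Riemannian manifold $(M,g)$ of dimension $n$ is locally flat if it is locally $2$-isometric to $(\mathbb{R}^n,g^{st})$. *)

theory Defs
  imports "HOL-Analysis.Analysis" "HOL-Library.Function_Algebras"
begin

instantiation "fun" :: (type, real_vector) real_vector
begin

definition scaleR_fun_def: "a *\<^sub>R f = (\<lambda>x. a *\<^sub>R f x)"

instance
  by standard (auto simp: scaleR_fun_def plus_fun_def fun_eq_iff algebra_simps)

end

text \<open>
  \<open>S\<close> is meant to be open. In finite dimension, continuity of all iterated directional
  derivatives is the usual \<open>C\<^sup>k\<close> condition.
\<close>

fun C_k_on :: "nat \<Rightarrow> ('v::euclidean_space \<Rightarrow> 'w::euclidean_space) \<Rightarrow> 'v set \<Rightarrow> bool" where
  "C_k_on 0 f S \<longleftrightarrow> continuous_on S f"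
| "C_k_on (Suc k) f S \<longleftrightarrow>
     (\<forall>x\<in>S. f differentiable (at x)) \<and>
     (\<forall>v. C_k_on k (\<lambda>x. frechet_derivative f (at x) v) S)"

definition smooth_on :: "'v::euclidean_space set \<Rightarrow> ('v \<Rightarrow> 'w::euclidean_space) \<Rightarrow> bool" where
  "smooth_on S f \<longleftrightarrow> (\<forall>k. C_k_on k f S)"

text \<open>
  A manifold of dimension \<open>CARD('n)\<close> is a topological space with an atlas of charts
  \<open>(U, \<psi>)\<close>; only the restriction of \<open>\<psi>\<close> to \<open>U\<close> matters. The atlas need not be
  maximal: all notions below depend only on the smooth structure it generates.
\<close>

record ('a, 'n::finite) mfd =
  mtop :: "'a topology"
  atlas :: "('a set \<times> ('a \<Rightarrow> real^'n)) set"

definition smooth_manifold :: "('a, 'n::finite) mfd \<Rightarrow> bool" where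
  "smooth_manifold M \<longleftrightarrow>
     Hausdorff_space (mtop M) \<and> second_countable (mtop M) \<and>
     (\<Union>(U, \<psi>)\<in>atlas M. U) = topspace (mtop M) \<and>
     (\<forall>(U, \<psi>)\<in>atlas M. openin (mtop M) U \<and> open (\<psi> ` U) \<and>
        homeomorphic_map (subtopology (mtop M) U) (top_of_set (\<psi> ` U)) \<psi>) \<and>
     (\<forall>(U, \<psi>)\<in>atlas M. \<forall>(V, \<eta>)\<in>atlas M.
        smooth_on (\<psi> ` (U \<inter> V)) (\<eta> \<circ> inv_into U \<psi>))"

definition euclid :: "(real^'n, 'n::finite) mfd" where
  "euclid = \<lparr>mtop = euclidean, atlas = {(UNIV, \<lambda>x. x)}\<rparr>"

definition open_sub :: "('a, 'n::finite) mfd \<Rightarrow> 'a set \<Rightarrow> ('a, 'n) mfd" where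
  "open_sub M W =
     \<lparr>mtop = subtopology (mtop M) W, atlas = (\<lambda>(U, \<psi>). (U \<inter> W, \<psi>)) ` atlas M\<rparr>"

definition smooth_map ::
  "('a, 'm::finite) mfd \<Rightarrow> ('b, 'n::finite) mfd \<Rightarrow> ('a \<Rightarrow> 'b) \<Rightarrow> bool" where
  "smooth_map M N h \<longleftrightarrow>
     continuous_map (mtop M) (mtop N) h \<and>
     (\<forall>(U, \<psi>)\<in>atlas M. \<forall>(V, \<eta>)\<in>atlas N.
        smooth_on (\<psi> ` (U \<inter> h -` V)) (\<eta> \<circ> h \<circ> inv_into U \<psi>))"

definition diffeomorphism ::
  "('a, 'm::finite) mfd \<Rightarrow> ('b, 'n::finite) mfd \<Rightarrow> ('a \<Rightarrow> 'b) \<Rightarrow> bool" where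
  "diffeomorphism M N h \<longleftrightarrow>
     smooth_map M N h \<and>
     (\<exists>k. smooth_map N M k \<and>
        (\<forall>p\<in>topspace (mtop M). k (h p) = p) \<and> (\<forall>q\<in>topspace (mtop N). h (k q) = q))"

definition smooth_fun :: "('a, 'n::finite) mfd \<Rightarrow> 'a set \<Rightarrow> ('a \<Rightarrow> real) \<Rightarrow> bool" where
  "smooth_fun M W f \<longleftrightarrow>
     openin (mtop M) W \<and>
     (\<forall>(U, \<psi>)\<in>atlas M. smooth_on (\<psi> ` (U \<inter> W)) (f \<circ> inv_into U \<psi>))"

definition smooth_near :: "('a, 'n::finite) mfd \<Rightarrow> 'a \<Rightarrow> ('a \<Rightarrow> real) \<Rightarrow> bool" where
  "smooth_near M p f \<longleftrightarrow> (\<exists>W. p \<in> W \<and> smooth_fun M W f)"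

text \<open>
  A tangent vector at \<open>p\<close> is the operator \<open>f \<mapsto> (f \<circ> c)'(0)\<close> of differentiation along
  a smooth curve \<open>c\<close> with \<open>c 0 = p\<close>, acting on the functions that are smooth near \<open>p\<close>.
  Operators are extended by \<open>0\<close> to all other functions, so that two tangent vectors are
  equal iff they agree on the functions smooth near \<open>p\<close>. With this convention an open
  submanifold has literally the same tangent spaces as the ambient manifold.
\<close>

type_synonym 'a tangent = "('a \<Rightarrow> real) \<Rightarrow> real"

definition smooth_curve_at ::
  "('a, 'n::finite) mfd \<Rightarrow> 'a \<Rightarrow> (real \<Rightarrow> 'a) \<Rightarrow> bool" where
  "smooth_curve_at M p c \<longleftrightarrow>
     c 0 = p \<and>
     (\<exists>e>0. continuous_map (top_of_set {-e<..<e}) (mtop M) c \<and>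
        (\<forall>(U, \<psi>)\<in>atlas M. smooth_on ({-e<..<e} \<inter> c -` U) (\<psi> \<circ> c)))"

definition velocity :: "('a, 'n::finite) mfd \<Rightarrow> (real \<Rightarrow> 'a) \<Rightarrow> 'a tangent" where
  "velocity M c = (\<lambda>f. if smooth_near M (c 0) f then deriv (f \<circ> c) 0 else 0)"

definition tangent_space :: "('a, 'n::finite) mfd \<Rightarrow> 'a \<Rightarrow> 'a tangent set" where
  "tangent_space M p = velocity M ` {c. smooth_curve_at M p c}"

text \<open>The differential of \<open>h\<close> at \<open>p\<close>, mapping \<open>T\<^sub>pM\<close> to the tangent space of \<open>N\<close> at \<open>h p\<close>.\<close>

definition differential ::
  "('b, 'n::finite) mfd \<Rightarrow> ('a \<Rightarrow> 'b) \<Rightarrow> 'a \<Rightarrow> 'a tangent \<Rightarrow> 'b tangent" where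
  "differential N h p v = (\<lambda>f. if smooth_near N (h p) f then v (f \<circ> h) else 0)"

definition vector_field :: "('a, 'n::finite) mfd \<Rightarrow> ('a \<Rightarrow> 'a tangent) \<Rightarrow> bool" where
  "vector_field M X \<longleftrightarrow>
     (\<forall>p\<in>topspace (mtop M). X p \<in> tangent_space M p) \<and>
     (\<forall>W f. smooth_fun M W f \<longrightarrow> smooth_fun M W (\<lambda>p. X p f))"

text \<open>The coordinate vector \<open>\<partial>/\<partial>x\<^sup>i\<close> of \<open>\<real>\<^sup>n\<close> at \<open>q\<close>.\<close>

definition coord_vector :: "real^'n \<Rightarrow> 'n::finite \<Rightarrow> (real^'n) tangent" where
  "coord_vector q i = velocity euclid (\<lambda>t. q + t *\<^sub>R axis i 1)"

text \<open>The identification of the tangent spaces of \<open>\<real>\<^sup>n\<close> with \<open>\<real>\<^sup>n\<close>.\<close>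

definition components :: "(real^'n) tangent \<Rightarrow> real^'n::finite" where
  "components v = (\<chi> i. v (\<lambda>x. x $ i))"

definition lin_dep :: "'v::real_vector \<Rightarrow> 'v \<Rightarrow> bool" where
  "lin_dep u v \<longleftrightarrow> (\<exists>a b. (a \<noteq> 0 \<or> b \<noteq> 0) \<and> a *\<^sub>R u + b *\<^sub>R v = 0)"

definition two_inner_product ::
  "'v::real_vector set \<Rightarrow> ('v \<Rightarrow> 'v \<Rightarrow> 'v \<Rightarrow> real) \<Rightarrow> bool" where
  "two_inner_product V g \<longleftrightarrow>
     subspace V \<and>
     (\<forall>u\<in>V. \<forall>v\<in>V. g u u v \<ge> 0 \<and> (g u u v = 0 \<longleftrightarrow> lin_dep u v)) \<and>
     (\<forall>u\<in>V. \<forall>v\<in>V. g u u v = g v v u) \<and>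
     (\<forall>u\<in>V. \<forall>v\<in>V. \<forall>w\<in>V. g u v w = g v u w) \<and>
     (\<forall>u\<in>V. \<forall>u'\<in>V. \<forall>v\<in>V. \<forall>w\<in>V. \<forall>a.
        g (a *\<^sub>R u + u') v w = a * g u v w + g u' v w)"

type_synonym 'a two_metric = "'a \<Rightarrow> 'a tangent \<Rightarrow> 'a tangent \<Rightarrow> 'a tangent \<Rightarrow> real"

definition two_riemannian_metric ::
  "('a, 'n::finite) mfd \<Rightarrow> 'a two_metric \<Rightarrow> bool" where
  "two_riemannian_metric M g \<longleftrightarrow>
     (\<forall>p\<in>topspace (mtop M). two_inner_product (tangent_space M p) (g p)) \<and>
     (\<forall>X Y Z. vector_field M X \<and> vector_field M Y \<and> vector_field M Z \<longrightarrow>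
        smooth_fun M (topspace (mtop M)) (\<lambda>p. g p (X p) (Y p) (Z p)))"

definition two_riemannian_manifold ::
  "('a, 'n::finite) mfd \<Rightarrow> 'a two_metric \<Rightarrow> bool" where
  "two_riemannian_manifold M g \<longleftrightarrow> smooth_manifold M \<and> two_riemannian_metric M g"

definition two_isometry ::
  "('a, 'm::finite) mfd \<Rightarrow> 'a two_metric \<Rightarrow> ('b, 'n::finite) mfd \<Rightarrow> 'b two_metric \<Rightarrow>
     ('a \<Rightarrow> 'b) \<Rightarrow> bool" where
  "two_isometry M g N g' h \<longleftrightarrow>
     diffeomorphism M N h \<and>
     (\<forall>p\<in>topspace (mtop M).
        \<forall>u\<in>tangent_space M p. \<forall>v\<in>tangent_space M p. \<forall>w\<in>tangent_space M p.
          g' (h p) (differential N h p u) (differential N h p v) (differential N h p w)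
          = g p u v w)"

definition locally_two_isometric ::
  "('a, 'm::finite) mfd \<Rightarrow> 'a two_metric \<Rightarrow> ('b, 'n::finite) mfd \<Rightarrow> 'b two_metric \<Rightarrow>
     bool" where
  "locally_two_isometric M g N g' \<longleftrightarrow>
     (\<forall>p\<in>topspace (mtop M). \<exists>U V. openin (mtop M) U \<and> p \<in> U \<and> openin (mtop N) V \<and>
        (\<exists>h. two_isometry (open_sub M U) g (open_sub N V) g' h))"

definition g_st :: "(real^'n::finite) two_metric" where
  "g_st p u v w =
     (let u' = components u; v' = components v; w' = components w
      in (u' \<bullet> v') * (w' \<bullet> w') - (u' \<bullet> w') * (v' \<bullet> w'))"

definition locally_flat :: "('a, 'n::finite) mfd \<Rightarrow> 'a two_metric \<Rightarrow> bool" where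
  "locally_flat M g \<longleftrightarrow> locally_two_isometric M g (euclid :: (real^'n, 'n) mfd) g_st"

definition coordinate_system ::
  "('a, 'n::finite) mfd \<Rightarrow> 'a \<Rightarrow> (real^'n) set \<Rightarrow> (real^'n \<Rightarrow> 'a) \<Rightarrow> bool" where
  "coordinate_system M p0 D \<phi> \<longleftrightarrow>
     open D \<and>
     (\<exists>W. openin (mtop M) W \<and> p0 \<in> W \<and> diffeomorphism (open_sub euclid D) (open_sub M W) \<phi>)"

definition metric_coeff ::
  "('a, 'n::finite) mfd \<Rightarrow> 'a two_metric \<Rightarrow> (real^'n \<Rightarrow> 'a) \<Rightarrow> 'n \<Rightarrow> 'n \<Rightarrow> 'n \<Rightarrow>
     real^'n \<Rightarrow> real" where
  "metric_coeff M g \<phi> i j k q =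
     g (\<phi> q) (differential M \<phi> q (coord_vector q i))
             (differential M \<phi> q (coord_vector q j))
             (differential M \<phi> q (coord_vector q k))"

definition partial_deriv :: "(real^'n \<Rightarrow> real) \<Rightarrow> 'n::finite \<Rightarrow> real^'n \<Rightarrow> real" where
  "partial_deriv a i q = frechet_derivative a (at q) (axis i 1)"

definition jacobian_minor ::
  "(real^'n \<Rightarrow> real) \<Rightarrow> (real^'n \<Rightarrow> real) \<Rightarrow> 'n::finite \<Rightarrow> 'n \<Rightarrow> real^'n \<Rightarrow> real" where
  "jacobian_minor a b i k q =
     partial_deriv a i q * partial_deriv b k q - partial_deriv a k q * partial_deriv b i q"

end

theory Submission
  imports Defs
begin

text \<open>
  A 2-isometry onto an open subset of \<open>\<real>\<^sup>3\<close> provides coordinates (its inverse) in which the identity solves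
  the system, by Lagrange's identity. Conversely, the system says that \<open>g\<close> and the pull-back of
  \<open>g\<^sup>s\<^sup>t\<close> under \<open>f \<circ> \<phi>\<^sup>-\<^sup>1\<close> agree on triples of coordinate vectors. In dimension 3 such triples
  determine a 2-inner product, so both agree everywhere; definiteness of \<open>g\<close> then makes \<open>Df\<close>
  injective, and the inverse function theorem turns \<open>f \<circ> \<phi>\<^sup>-\<^sup>1\<close> into a local 2-isometry.
\<close>

section \<open>Smooth functions on Euclidean spaces\<close>

text \<open>The obstacle is the third argument. The axioms give bilinearity in the first two
  arguments, while the dependence on the third is quadratic; the system tests the third argument
  only at single coordinate vectors, and a quadratic map is not determined by its values on a basis.
  The missing mixed terms come from the exchange law g(u,u/v) = g(v,v/u) together with g(u,v/u) = 0,
  applied to sums of two basis vectors: they change sign under a cyclic shift of three distinct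
  indices, and three sign changes force zero. Positivity plays two parts: nonnegativity yields
  g(u,v/u) = 0, and definiteness excludes a kernel of Df. All of this is algebra in a single tangent
  space. The analysis has to identify that space, a set of operators on functions, with R^3 through
  the coordinates (\<open>tvec\<close>), and to provide smooth local inverses. A solution f may fail
  to be injective, so the isometry is built on a possibly smaller neighbourhood than the image of
  \<open>\<phi>\<close>.\<close>

lemma frechet_derivative_cong_open:
  assumes "open S" "x \<in> S" "\<And>y. y \<in> S \<Longrightarrow> f y = g y"
  shows "frechet_derivative f (at x) = frechet_derivative g (at x)"
proof -
  have "(f has_derivative D) (at x) \<longleftrightarrow> (g has_derivative D) (at x)" for D
    using assms has_derivative_transform_within_open[of f D x UNIV S g]
      has_derivative_transform_within_open[of g D x UNIV S f] by auto
  then show ?thesis by (simp add: frechet_derivative_def)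
qed

text \<open>Derivatives are taken in the ambient space, so agreement on \<open>S\<close> carries
  over to them because every point of \<open>S\<close> is interior; the induction then passes to
  each directional derivative.\<close>

lemma C_k_on_cong:
  assumes "open S" "\<And>x. x \<in> S \<Longrightarrow> f x = g x"
  shows "C_k_on k f S \<longleftrightarrow> C_k_on k g S"
  using assms(2)
proof (induction k arbitrary: f g)
  case 0
  then show ?case by (simp cong: continuous_on_cong)
next
  case (Suc k)
  have "f differentiable (at x) \<longleftrightarrow> g differentiable (at x)" if "x \<in> S" for x
    using Suc.prems that assms(1) unfolding differentiable_def
    by (metis has_derivative_transform_within_open)
  moreover have "C_k_on k (\<lambda>x. frechet_derivative f (at x) v) S
      \<longleftrightarrow> C_k_on k (\<lambda>x. frechet_derivative g (at x) v) S" for v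
    by (rule Suc.IH) (metis frechet_derivative_cong_open Suc.prems assms(1))
  ultimately show ?case by simp
qed

lemma smooth_on_cong:
  "open S \<Longrightarrow> (\<And>x. x \<in> S \<Longrightarrow> f x = g x) \<Longrightarrow> smooth_on S f \<longleftrightarrow> smooth_on S g"
  unfolding smooth_on_def using C_k_on_cong by blast

lemma C_k_on_subset: "C_k_on k f S \<Longrightarrow> T \<subseteq> S \<Longrightarrow> C_k_on k f T"
  by (induction k arbitrary: f) (auto intro: continuous_on_subset)

lemma smooth_on_subset: "smooth_on S f \<Longrightarrow> T \<subseteq> S \<Longrightarrow> smooth_on T f"
  unfolding smooth_on_def using C_k_on_subset by blast

lemma C_k_on_Union:
  assumes "\<And>T. T \<in> \<T> \<Longrightarrow> open T" "\<And>T. T \<in> \<T> \<Longrightarrow> C_k_on k f T"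
  shows "C_k_on k f (\<Union>\<T>)"
  using assms(2)
proof (induction k arbitrary: f)
  case 0
  then show ?case using assms(1) by (auto intro: continuous_on_open_Union)
qed auto

lemma smooth_on_Union:
  assumes "\<And>T. T \<in> \<T> \<Longrightarrow> open T" "\<And>T. T \<in> \<T> \<Longrightarrow> smooth_on T f"
  shows "smooth_on (\<Union>\<T>) f"
  using assms C_k_on_Union unfolding smooth_on_def by blast

lemma C_k_on_imp_continuous_on: "C_k_on k f S \<Longrightarrow> continuous_on S f"
  by (cases k) (auto intro!: continuous_at_imp_continuous_on differentiable_imp_continuous_within)

lemma C_k_on_SucD: "C_k_on (Suc k) f S \<Longrightarrow> C_k_on k f S"
proof (induction k arbitrary: f)
  case 0
  then show ?case by (simp only: C_k_on.simps(1)) (rule C_k_on_imp_continuous_on)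
next
  case (Suc k)
  then show ?case by (metis C_k_on.simps(2))
qed

lemma smooth_on_imp_continuous_on: "smooth_on S f \<Longrightarrow> continuous_on S f"
  using C_k_on_imp_continuous_on smooth_on_def by blast

lemma smooth_on_imp_differentiable: "smooth_on S f \<Longrightarrow> x \<in> S \<Longrightarrow> f differentiable (at x)"
  unfolding smooth_on_def by (metis C_k_on.simps(2))

lemma smooth_on_has_derivative:
  "smooth_on S f \<Longrightarrow> x \<in> S \<Longrightarrow> (f has_derivative frechet_derivative f (at x)) (at x)"
  by (simp add: smooth_on_imp_differentiable flip: frechet_derivative_works)

lemma smooth_on_frechet_derivative:
  "smooth_on S f \<Longrightarrow> smooth_on S (\<lambda>x. frechet_derivative f (at x) v)"
  unfolding smooth_on_def by (metis C_k_on.simps(2))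

lemma C_k_on_const: "C_k_on k (\<lambda>x. c) S"
  by (induction k arbitrary: c) auto

lemma C_k_on_linear:
  fixes f :: "'a::euclidean_space \<Rightarrow> 'b::euclidean_space"
  assumes "linear f" shows "C_k_on k f S"
proof (cases k)
  case 0
  then show ?thesis using assms by (simp add: linear_continuous_on linear_conv_bounded_linear)
next
  case (Suc m)
  have *: "(f has_derivative f) (at x)" for x
    using assms by (simp add: linear_conv_bounded_linear bounded_linear_imp_has_derivative)
  have "frechet_derivative f (at x) = f" for x
    using frechet_derivative_at[OF *] by simp
  then show ?thesis using Suc * by (auto simp: C_k_on_const differentiable_def)
qed

text \<open>\<open>frechet_derivative\<close> is a choice operator. By uniqueness any formula
  \<open>D\<close> for the derivative equals it, so the inductions below only have to supply a
  differentiation rule whose right-hand side stays in the class.\<close>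

lemma C_k_on_derivI:
  assumes S: "open S"
    and D: "\<And>x. x \<in> S \<Longrightarrow> (f has_derivative D x) (at x)"
    and C: "\<And>v. C_k_on k (\<lambda>x. D x v) S"
  shows "C_k_on (Suc k) f S"
proof -
  have "frechet_derivative f (at x) = D x" if "x \<in> S" for x
    using frechet_derivative_at[OF D[OF that]] by simp
  then have "C_k_on k (\<lambda>x. frechet_derivative f (at x) v) S" for v
    using C_k_on_cong[OF S, of "\<lambda>x. frechet_derivative f (at x) v" "\<lambda>x. D x v"] C by simp
  then show ?thesis using D by (auto simp: differentiable_def)
qed

lemma C_k_on_derivD:
  assumes "C_k_on (Suc k) f S"
  shows "\<And>x. x \<in> S \<Longrightarrow> (f has_derivative frechet_derivative f (at x)) (at x)"
    and "\<And>v. C_k_on k (\<lambda>x. frechet_derivative f (at x) v) S"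
  using assms by (auto simp flip: frechet_derivative_works)

lemma C_k_on_add:
  assumes S: "open S" and "C_k_on k f S" "C_k_on k g S"
  shows "C_k_on k (\<lambda>x. f x + g x) S"
  using assms(2,3)
proof (induction k arbitrary: f g)
  case 0
  then show ?case by (simp add: continuous_on_add)
next
  case (Suc k)
  note f = C_k_on_derivD[OF Suc.prems(1)] and g = C_k_on_derivD[OF Suc.prems(2)]
  show ?case
    by (rule C_k_on_derivI[OF S has_derivative_add[OF f(1) g(1)]]) (auto intro: Suc.IH f(2) g(2))
qed

lemma C_k_on_sum:
  assumes "open S" "finite I" "\<And>i. i \<in> I \<Longrightarrow> C_k_on k (f i) S"
  shows "C_k_on k (\<lambda>x. \<Sum>i\<in>I. f i x) S"
  using assms(2,3) by (induction I) (auto intro: C_k_on_const C_k_on_add[OF assms(1)])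

lemma C_k_on_bilinear:
  assumes S: "open S" and h: "bounded_bilinear h" and "C_k_on k f S" "C_k_on k g S"
  shows "C_k_on k (\<lambda>x. h (f x) (g x)) S"
  using assms(3,4)
proof (induction k arbitrary: f g)
  case 0
  then show ?case by (simp add: bounded_bilinear.continuous_on[OF h])
next
  case (Suc k)
  note f = C_k_on_derivD[OF Suc.prems(1)] and g = C_k_on_derivD[OF Suc.prems(2)]
  show ?case
  proof (rule C_k_on_derivI[OF S])
    show "((\<lambda>x. h (f x) (g x)) has_derivative
        (\<lambda>v. h (f x) (frechet_derivative g (at x) v) + h (frechet_derivative f (at x) v) (g x))) (at x)"
      if "x \<in> S" for x
      by (rule bounded_bilinear.FDERIV[OF h f(1)[OF that] g(1)[OF that]])
    show "C_k_on k (\<lambda>x. h (f x) (frechet_derivative g (at x) v)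
        + h (frechet_derivative f (at x) v) (g x)) S" for v
      by (intro C_k_on_add[OF S] Suc.IH f g C_k_on_SucD[OF Suc.prems(1)] C_k_on_SucD[OF Suc.prems(2)])
  qed
qed

lemmas C_k_on_mult = C_k_on_bilinear[OF _ bounded_bilinear_mult]
lemmas C_k_on_scaleR = C_k_on_bilinear[OF _ bounded_bilinear_scaleR]

lemma C_k_on_prod:
  fixes f :: "'i \<Rightarrow> 'a::euclidean_space \<Rightarrow> real"
  assumes "open S" "finite I" "\<And>i. i \<in> I \<Longrightarrow> C_k_on k (f i) S"
  shows "C_k_on k (\<lambda>x. \<Prod>i\<in>I. f i x) S"
  using assms(2,3) by (induction I) (auto intro: C_k_on_const C_k_on_mult[OF assms(1)])

lemma C_k_on_inner_right:
  assumes "open S" "C_k_on k f S" shows "C_k_on k (\<lambda>x. f x \<bullet> c) S"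
  by (rule C_k_on_bilinear[OF assms(1) bounded_bilinear_inner assms(2) C_k_on_const])

text \<open>The chain rule evaluates the derivative of \<open>g\<close> in a direction that moves
  with \<open>x\<close>, whereas \<open>C_k_on\<close> controls fixed directions. Expanding that
  direction in \<open>Basis\<close> moves the variation into scalar coefficients, and the induction
  hypothesis applies to the directional derivatives of \<open>g\<close>.\<close>

lemma C_k_on_compose:
  fixes f :: "'a::euclidean_space \<Rightarrow> 'b::euclidean_space" and g :: "'b \<Rightarrow> 'c::euclidean_space"
  assumes S: "open S" and T: "open T" and sub: "f ` S \<subseteq> T"
    and f: "C_k_on k f S" and g: "C_k_on k g T"
  shows "C_k_on k (\<lambda>x. g (f x)) S"
  using f g
proof (induction k arbitrary: g)
  case 0
  then show ?case using sub by (auto intro: continuous_on_compose2)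
next
  case (Suc k)
  note f = C_k_on_derivD[OF Suc.prems(1)] and g = C_k_on_derivD[OF Suc.prems(2)]
  let ?D = "\<lambda>y. frechet_derivative g (at y)"
  show ?case
  proof (rule C_k_on_derivI[OF S])
    fix x assume x: "x \<in> S"
    have lin: "linear (?D (f x))"
      using g(1) x sub has_derivative_linear by blast
    have "((\<lambda>x. g (f x)) has_derivative (\<lambda>v. ?D (f x) (frechet_derivative f (at x) v))) (at x)"
      using has_derivative_compose[OF f(1)[OF x], of g] g(1)[of "f x"] x sub by auto
    also have "(\<lambda>v. ?D (f x) (frechet_derivative f (at x) v))
       = (\<lambda>v. \<Sum>b\<in>Basis. (frechet_derivative f (at x) v \<bullet> b) *\<^sub>R ?D (f x) b)"
      (is "_ = ?R")
    proof
      fix v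
      have "?D (f x) (frechet_derivative f (at x) v)
         = ?D (f x) (\<Sum>b\<in>Basis. (frechet_derivative f (at x) v \<bullet> b) *\<^sub>R b)"
        by (simp add: euclidean_representation)
      then show "?D (f x) (frechet_derivative f (at x) v) = ?R v"
        by (simp add: linear_sum[OF lin] linear_cmul[OF lin])
    qed
    finally show "((\<lambda>x. g (f x)) has_derivative ?R) (at x)" .
  next
    fix v
    show "C_k_on k (\<lambda>x. \<Sum>b\<in>Basis. (frechet_derivative f (at x) v \<bullet> b) *\<^sub>R ?D (f x) b) S"
      by (intro C_k_on_sum[OF S] C_k_on_scaleR[OF S] C_k_on_inner_right[OF S] Suc.IH f g
            C_k_on_SucD[OF Suc.prems(1)]) simp
  qed
qed

lemma smooth_on_compose:
  assumes "open S" "open T" "f ` S \<subseteq> T" "smooth_on S f" "smooth_on T g"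
  shows "smooth_on S (\<lambda>x. g (f x))"
  using assms C_k_on_compose unfolding smooth_on_def by blast

lemma smooth_on_linear: "linear f \<Longrightarrow> smooth_on S f"
  by (simp add: smooth_on_def C_k_on_linear)

lemma smooth_on_ident: "smooth_on S (\<lambda>x. x)"
  by (rule smooth_on_linear) (simp add: linear_iff)

text \<open>The derivative is a polynomial in \<open>inverse\<close> itself, so the induction
  closes.\<close>

lemma C_k_on_inverse:
  fixes S :: "real set" assumes "open S" "0 \<notin> S"
  shows "C_k_on k inverse S"
proof (induction k)
  case 0
  show ?case using assms(2) by (auto intro!: continuous_intros)
next
  case (Suc k)
  show ?case
  proof (rule C_k_on_derivI[OF assms(1)])
    show "(inverse has_derivative (\<lambda>v. (inverse x * inverse x) * (- v))) (at x)" if "x \<in> S" for x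
      using that assms(2)
      by (auto intro!: derivative_eq_intros)
    show "C_k_on k (\<lambda>x. (inverse x * inverse x) * (- v)) S" for v
      by (intro C_k_on_mult[OF assms(1)] Suc C_k_on_const)
  qed
qed

lemma C_k_on_divide:
  fixes f g :: "'a::euclidean_space \<Rightarrow> real"
  assumes "open S" "C_k_on k f S" "C_k_on k g S" "\<And>x. x \<in> S \<Longrightarrow> g x \<noteq> 0"
  shows "C_k_on k (\<lambda>x. f x / g x) S"
  unfolding divide_inverse
  by (intro C_k_on_mult assms C_k_on_compose[OF assms(1), of "-{0}" g])
     (use assms(4) in \<open>auto intro: C_k_on_inverse\<close>)

lemma C_k_on_vec:
  fixes f :: "'a::euclidean_space \<Rightarrow> real^'n"
  assumes S: "open S" and f: "\<And>i. C_k_on k (\<lambda>x. f x $ i) S"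
  shows "C_k_on k f S"
proof -
  have "C_k_on k (\<lambda>x. \<Sum>i\<in>UNIV. f x $ i *\<^sub>R axis i 1) S"
    by (intro C_k_on_sum[OF S] C_k_on_scaleR[OF S] f C_k_on_const) simp
  also have "(\<lambda>x. \<Sum>i\<in>UNIV. f x $ i *\<^sub>R axis i 1) = f"
    using basis_expansion[of "f _"] by (auto simp: scalar_mult_eq_scaleR)
  finally show ?thesis .
qed

lemma C_k_on_vec_nth:
  fixes f :: "'a::euclidean_space \<Rightarrow> real^'n"
  assumes S: "open S" and f: "C_k_on k f S"
  shows "C_k_on k (\<lambda>x. f x $ i) S"
  using C_k_on_inner_right[OF assms, of "axis i 1"] by (simp add: inner_axis)

lemma C_k_on_det:
  fixes A :: "'a::euclidean_space \<Rightarrow> real^'n^'n"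
  assumes S: "open S" and A: "\<And>i j. C_k_on k (\<lambda>x. A x $ i $ j) S"
  shows "C_k_on k (\<lambda>x. det (A x)) S"
  unfolding det_def
  by (intro C_k_on_sum[OF S] C_k_on_mult[OF S] C_k_on_const C_k_on_prod[OF S] A)
     (auto simp: finite_permutations)

text \<open>By Cramer's rule the derivative of the inverse is a rational function of the derivative
  of \<open>f\<close>, so regularity of the inverse bootstraps.\<close>

lemma smooth_on_inverse:
  fixes f g :: "real^'n \<Rightarrow> real^'n"
  assumes S: "open S" and T: "open T" and gT: "g ` T \<subseteq> S"
    and f: "smooth_on S f"
    and g: "\<And>y. y \<in> T \<Longrightarrow> (g has_derivative g' y) (at y)"
    and g': "\<And>y. y \<in> T \<Longrightarrow> g' y = inv (frechet_derivative f (at (g y)))"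
    and bij: "\<And>y. y \<in> T \<Longrightarrow> bij (frechet_derivative f (at (g y)))"
  shows "smooth_on T g"
proof -
  define A where "A y = matrix (frechet_derivative f (at (g y)))" for y
  have lin: "linear (frechet_derivative f (at (g y)))" if "y \<in> T" for y
    using smooth_on_has_derivative[OF f] has_derivative_linear gT that by blast
  have A: "A y *v x = frechet_derivative f (at (g y)) x" if "y \<in> T" for x y
    unfolding A_def by (rule matrix_works) (use lin[OF that] in \<open>simp add: linear_matrix_vector_mul_eq\<close>)
  have det: "det (A y) \<noteq> 0" if "y \<in> T" for y
  proof -
    have "inj ((*v) (A y))"
      using bij[OF that] A[OF that] by (auto simp: bij_def inj_def)
    then show ?thesis
      by (metis invertible_det_nz invertible_left_inverse matrix_left_invertible_injective)
  qed
  have inv: "g' y v = (\<chi> k. det (\<chi> i j. if j = k then v $ i else A y $ i $ j) / det (A y))"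
    if "y \<in> T" for y v
  proof -
    have "A y *v g' y v = v"
      using g'[OF that] A[OF that] bij[OF that] by (simp add: bij_is_surj surj_f_inv_f)
    then show ?thesis using cramer[OF det[OF that]] by simp
  qed
  have "C_k_on k g T" for k
  proof (induction k)
    case 0
    show ?case using g by (auto intro!: continuous_at_imp_continuous_on has_derivative_continuous)
  next
    case (Suc k)
    have Aij: "C_k_on k (\<lambda>y. A y $ i $ j) T" for i j
    proof -
      have "C_k_on k (\<lambda>x. frechet_derivative f (at x) (axis j 1)) S"
        using smooth_on_frechet_derivative[OF f] by (simp add: smooth_on_def)
      then have "C_k_on k (\<lambda>y. frechet_derivative f (at (g y)) (axis j 1)) T"
        by (rule C_k_on_compose[OF T S gT Suc])
      then show ?thesis
        using C_k_on_vec_nth[OF T] by (fastforce simp: A_def matrix_def)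
    qed
    show ?case
    proof (rule C_k_on_derivI[OF T g])
      fix v
      let ?h = "\<lambda>y. \<chi> k. det (\<chi> i j. if j = k then v $ i else A y $ i $ j) / det (A y)"
      have "C_k_on k ?h T"
      proof (rule C_k_on_vec[OF T])
        fix i
        have "C_k_on k (\<lambda>y. det (\<chi> ia j. if j = i then v $ ia else A y $ ia $ j) / det (A y)) T"
        proof (intro C_k_on_divide[OF T] C_k_on_det[OF T] Aij)
          fix a b
          show "C_k_on k (\<lambda>y. (\<chi> ia j. if j = i then v $ ia else A y $ ia $ j) $ a $ b) T"
            by (cases "b = i") (simp_all add: C_k_on_const Aij)
        qed (rule det)
        then show "C_k_on k (\<lambda>y. ?h y $ i) T" by simp
      qed
      then show "C_k_on k (\<lambda>y. g' y v) T"
        using C_k_on_cong[OF T, of "\<lambda>y. g' y v" ?h] inv by simp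
    qed
  qed
  then show ?thesis by (simp add: smooth_on_def)
qed

text \<open>Adapts \<open>inverse_function_theorem\<close>, which takes the derivative as a
  continuous family of bounded operators: in finite dimension continuity may be tested on single
  vectors, and the injective derivative at \<open>x0\<close> has a linear left inverse. The
  differentiable inverse so obtained is smooth by \<open>smooth_on_inverse\<close>.\<close>

lemma smooth_inverse_function:
  fixes f :: "real^'n \<Rightarrow> real^'n"
  assumes S: "open S" and f: "smooth_on S f" and x0: "x0 \<in> S"
    and inj: "inj (frechet_derivative f (at x0))"
  obtains U V g where "open U" "U \<subseteq> S" "x0 \<in> U" "open V" "homeomorphism U V f g" "smooth_on V g"
proof -
  define F where "F x = Blinfun (frechet_derivative f (at x))" for x
  have F: "blinfun_apply (F x) = frechet_derivative f (at x)" if "x \<in> S" for x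
    unfolding F_def
    by (rule bounded_linear_Blinfun_apply)
       (use smooth_on_has_derivative[OF f that] has_derivative_bounded_linear in blast)
  have lin0: "linear (frechet_derivative f (at x0))"
    using smooth_on_has_derivative[OF f x0] has_derivative_linear by blast
  obtain l where l: "linear l" "l \<circ> frechet_derivative f (at x0) = id"
    using linear_injective_left_inverse[OF lin0 inj] by blast
  have invF: "Blinfun l o\<^sub>L F x0 = id_blinfun"
  proof (rule blinfun_eqI)
    fix i
    show "blinfun_apply (Blinfun l o\<^sub>L F x0) i = blinfun_apply id_blinfun i"
      using l by (simp add: F[OF x0] bounded_linear_Blinfun_apply linear_conv_bounded_linear
          pointfree_idE)
  qed
  have contF: "continuous_on S F"
  proof (rule continuous_on_blinfun_componentwise)
    fix b :: "real^'n"
    have "continuous_on S (\<lambda>x. frechet_derivative f (at x) b)"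
      by (rule smooth_on_imp_continuous_on[OF smooth_on_frechet_derivative[OF f]])
    then show "continuous_on S (\<lambda>x. blinfun_apply (F x) b)"
      by (simp add: F cong: continuous_on_cong)
  qed
  have derF: "\<And>x. x \<in> S \<Longrightarrow> (f has_derivative blinfun_apply (F x)) (at x)"
    using smooth_on_has_derivative[OF f] F by simp
  obtain U V g g' where *: "open U" "U \<subseteq> S" "x0 \<in> U" "open V" "f x0 \<in> V" "homeomorphism U V f g"
    "\<And>y. y \<in> V \<Longrightarrow> (g has_derivative (g' y)) (at y)"
    "\<And>y. y \<in> V \<Longrightarrow> g' y = inv (blinfun_apply (F (g y)))"
    "\<And>y. y \<in> V \<Longrightarrow> bij (blinfun_apply (F (g y)))"
    by (rule inverse_function_theorem[OF S derF contF x0 invF]) auto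
  have gV: "g ` V \<subseteq> S" using *(2,6) by (auto simp: homeomorphism_def)
  have "smooth_on V g"
    by (rule smooth_on_inverse[OF S *(4) gV f *(7)])
       (use *(8,9) F gV in \<open>auto simp: image_subset_iff\<close>)
  with * that show ?thesis by blast
qed

section \<open>Smoothness in charts\<close>

text \<open>Openness of the domains is part of the notion, so that it is preserved by composition
  without reference to the topologies of the manifolds.\<close>

definition charts_smooth ::
  "('a set \<times> ('a \<Rightarrow> 'v::euclidean_space)) set \<Rightarrow> ('b set \<times> ('b \<Rightarrow> 'w::euclidean_space)) set \<Rightarrow>
     ('a \<Rightarrow> 'b) \<Rightarrow> bool" where
  "charts_smooth A B h \<longleftrightarrow>
     (\<forall>(U, \<psi>)\<in>A. \<forall>(V, \<eta>)\<in>B.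
        open (\<psi> ` (U \<inter> h -` V)) \<and> smooth_on (\<psi> ` (U \<inter> h -` V)) (\<eta> \<circ> h \<circ> inv_into U \<psi>))"

lemma charts_smoothD:
  assumes "charts_smooth A B h" "(U, \<psi>) \<in> A" "(V, \<eta>) \<in> B"
  shows "open (\<psi> ` (U \<inter> h -` V))" "smooth_on (\<psi> ` (U \<inter> h -` V)) (\<eta> \<circ> h \<circ> inv_into U \<psi>)"
  using assms unfolding charts_smooth_def by fast+

text \<open>Through a chart \<open>(V, \<eta>)\<close> of the middle space the composite is
  \<open>?H\<close> after \<open>?G\<close>, the two coordinate expressions. The sets
  \<open>S V\<close> where this applies are open preimages, they exhaust the domain by
  \<open>cover\<close>, and smoothness is local.\<close>

lemma charts_smooth_compose:
  assumes AB: "charts_smooth A B h" and BC: "charts_smooth B C k"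
    and injA: "\<And>U \<psi>. (U, \<psi>) \<in> A \<Longrightarrow> inj_on \<psi> U"
    and injB: "\<And>V \<eta>. (V, \<eta>) \<in> B \<Longrightarrow> inj_on \<eta> V"
    and cover: "\<And>U \<psi> p. (U, \<psi>) \<in> A \<Longrightarrow> p \<in> U \<Longrightarrow> \<exists>V \<eta>. (V, \<eta>) \<in> B \<and> h p \<in> V"
  shows "charts_smooth A C (k \<circ> h)"
  unfolding charts_smooth_def
proof clarify
  fix U \<psi> W \<zeta> assume A: "(U, \<psi>) \<in> A" and C: "(W, \<zeta>) \<in> C"
  let ?F = "\<zeta> \<circ> (k \<circ> h) \<circ> inv_into U \<psi>"
  define S where "S V = \<psi> ` (U \<inter> h -` V \<inter> (k \<circ> h) -` W)" for V
  have *: "open (S V) \<and> smooth_on (S V) ?F" if B: "(V, \<eta>) \<in> B" for V \<eta>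
  proof -
    let ?G = "\<eta> \<circ> h \<circ> inv_into U \<psi>" and ?H = "\<zeta> \<circ> k \<circ> inv_into V \<eta>"
    note G = charts_smoothD[OF AB A B] and H = charts_smoothD[OF BC B C]
    have "S V = \<psi> ` (U \<inter> h -` V) \<inter> ?G -` (\<eta> ` (V \<inter> k -` W))"
      using injA[OF A] injB[OF B] by (auto simp: S_def inj_on_eq_iff)
    moreover have "open \<dots>"
      by (rule continuous_open_preimage[OF smooth_on_imp_continuous_on[OF G(2)] G(1) H(1)])
    ultimately have op: "open (S V)" by simp
    have "smooth_on (S V) (\<lambda>x. ?H (?G x))"
      by (rule smooth_on_compose[OF op H(1) _ smooth_on_subset[OF G(2)] H(2)])
         (use injA[OF A] in \<open>auto simp: S_def\<close>)
    then have "smooth_on (S V) ?F"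
      by (rule iffD1[OF smooth_on_cong[OF op], rotated])
         (use injA[OF A] injB[OF B] in \<open>auto simp: S_def\<close>)
    with op show ?thesis by simp
  qed
  have eq: "\<psi> ` (U \<inter> (k \<circ> h) -` W) = \<Union>(S ` fst ` B)"
    using cover[OF A] by (force simp: S_def)
  have "open (\<Union>(S ` fst ` B))" using * by (intro open_UN) auto
  moreover have "smooth_on (\<Union>(S ` fst ` B)) ?F"
    by (rule smooth_on_Union) (use * in auto)
  ultimately show "open (\<psi> ` (U \<inter> (k \<circ> h) -` W)) \<and>
      smooth_on (\<psi> ` (U \<inter> (k \<circ> h) -` W)) (\<zeta> \<circ> (k \<circ> h) \<circ> inv_into U \<psi>)"
    unfolding eq by blast
qed

section \<open>Open submanifolds and smooth maps between manifolds\<close>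

lemma atlas_open_sub: "atlas (open_sub M W) = (\<lambda>(U, \<psi>). (U \<inter> W, \<psi>)) ` atlas M"
  and mtop_open_sub: "mtop (open_sub M W) = subtopology (mtop M) W"
  by (simp_all add: open_sub_def)

lemma open_sub_UNIV: "open_sub (M :: ('a, 'n::finite) mfd) UNIV = M"
  by (simp add: open_sub_def case_prod_beta)

lemma open_sub_open_sub: "open_sub (open_sub M W) W' = open_sub M (W \<inter> W')"
  by (force simp: open_sub_def subtopology_subtopology image_image Int_assoc case_prod_beta)

lemma smooth_manifold_chart:
  assumes "smooth_manifold M" "(U, \<psi>) \<in> atlas M"
  shows "openin (mtop M) U"
    and "homeomorphic_map (subtopology (mtop M) U) (top_of_set (\<psi> ` U)) \<psi>"
    and "open (\<psi> ` U)"
  using assms unfolding smooth_manifold_def by fast+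

lemma chart_inj: "smooth_manifold M \<Longrightarrow> (U, \<psi>) \<in> atlas M \<Longrightarrow> inj_on \<psi> U"
  using smooth_manifold_chart[of M U \<psi>] openin_subset[of "mtop M" U]
  by (auto dest!: homeomorphic_imp_injective_map simp: Int_absorb1)

lemma chart_subset: "smooth_manifold M \<Longrightarrow> (U, \<psi>) \<in> atlas M \<Longrightarrow> U \<subseteq> topspace (mtop M)"
  by (simp add: openin_subset smooth_manifold_chart(1))

lemma chart_cover:
  assumes "smooth_manifold M" "p \<in> topspace (mtop M)"
  obtains U \<psi> where "(U, \<psi>) \<in> atlas M" "p \<in> U"
  using assms unfolding smooth_manifold_def by blast

lemma chart_open_image:
  assumes "smooth_manifold M" "(U, \<psi>) \<in> atlas M" "openin (mtop M) W" "W \<subseteq> U"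
  shows "open (\<psi> ` W)"
proof -
  note c = smooth_manifold_chart[OF assms(1,2)]
  have "openin (subtopology (mtop M) U) W"
    using assms(3,4) c(1) by (simp add: openin_open_subtopology)
  then have "openin (top_of_set (\<psi> ` U)) (\<psi> ` W)"
    using homeomorphic_map_openness_eq[OF c(2)] by blast
  then show ?thesis using c(3) openin_open_trans by blast
qed

text \<open>Continuity is what makes the coordinate domains in \<open>charts_smooth\<close> open:
  the preimage of a chart domain is open in \<open>M\<close>, and charts send open sets to open
  sets.\<close>

lemma smooth_map_iff:
  assumes "smooth_manifold M" "smooth_manifold N"
  shows "smooth_map M N h \<longleftrightarrow>
    continuous_map (mtop M) (mtop N) h \<and> charts_smooth (atlas M) (atlas N) h"
proof -
  have "open (\<psi> ` (U \<inter> h -` V))"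
    if "continuous_map (mtop M) (mtop N) h" "(U, \<psi>) \<in> atlas M" "(V, \<eta>) \<in> atlas N" for U \<psi> V \<eta>
  proof -
    have "U \<inter> h -` V = U \<inter> {x \<in> topspace (mtop M). h x \<in> V}"
      using chart_subset[OF assms(1) that(2)] by auto
    moreover have "openin (mtop M) \<dots>"
      by (intro openin_Int smooth_manifold_chart(1)[OF assms(1) that(2)]
            openin_continuous_map_preimage[OF that(1)] smooth_manifold_chart(1)[OF assms(2) that(3)])
    ultimately show ?thesis using chart_open_image[OF assms(1) that(2)] by simp
  qed
  note op = this
  show ?thesis
  proof
    assume L: "smooth_map M N h"
    then have h: "continuous_map (mtop M) (mtop N) h" unfolding smooth_map_def by (rule conjunct1)
    have "smooth_on (\<psi> ` (U \<inter> h -` V)) (\<eta> \<circ> h \<circ> inv_into U \<psi>)"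
      if "(U, \<psi>) \<in> atlas M" "(V, \<eta>) \<in> atlas N" for U \<psi> V \<eta>
      using L[unfolded smooth_map_def, THEN conjunct2] that by blast
    then have "charts_smooth (atlas M) (atlas N) h"
      unfolding charts_smooth_def using op[OF h] by auto
    with h show "continuous_map (mtop M) (mtop N) h \<and> charts_smooth (atlas M) (atlas N) h" ..
  next
    assume R: "continuous_map (mtop M) (mtop N) h \<and> charts_smooth (atlas M) (atlas N) h"
    then show "smooth_map M N h"
      unfolding smooth_map_def charts_smooth_def by auto
  qed
qed

text \<open>Serves three purposes: compatibility of the restricted charts (\<open>W = W'\<close>),
  smoothness of inclusions (\<open>W' = UNIV\<close>) and corestriction of smooth maps
  (\<open>W = UNIV\<close>). Intersecting with the underlying space in the hypotheses admits
  \<open>UNIV\<close>, which need not be an open set of \<open>M\<close>.\<close>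

lemma charts_smooth_open_sub:
  assumes M: "smooth_manifold M"
    and W: "openin (mtop M) (topspace (mtop M) \<inter> W)" and W': "openin (mtop M) (topspace (mtop M) \<inter> W')"
  shows "charts_smooth (atlas (open_sub M W)) (atlas (open_sub M W')) (\<lambda>x. x)"
  unfolding charts_smooth_def atlas_open_sub
proof clarify
  fix U \<psi> V \<eta> assume U: "(U, \<psi>) \<in> atlas M" and V: "(V, \<eta>) \<in> atlas M"
  let ?S = "U \<inter> W \<inter> (\<lambda>x. x) -` (V \<inter> W')"
  have "?S = U \<inter> (topspace (mtop M) \<inter> W) \<inter> (V \<inter> (topspace (mtop M) \<inter> W'))"
    using chart_subset[OF M U] by auto
  moreover have "openin (mtop M) \<dots>"
    using W W' smooth_manifold_chart(1)[OF M] U V by blast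
  ultimately have op: "open (\<psi> ` ?S)"
    using chart_open_image[OF M U, of ?S] by auto
  have "smooth_on (\<psi> ` (U \<inter> V)) (\<eta> \<circ> inv_into U \<psi>)"
    using M U V unfolding smooth_manifold_def by fast
  then have "smooth_on (\<psi> ` ?S) (\<eta> \<circ> inv_into U \<psi>)"
    by (rule smooth_on_subset) auto
  \<comment> \<open>\<open>inv_into U \<psi>\<close> and
    \<open>inv_into (U \<inter> W) \<psi>\<close> may differ elsewhere, but agree on this open
    set.\<close>
  then have "smooth_on (\<psi> ` ?S) (\<eta> \<circ> (\<lambda>x. x) \<circ> inv_into (U \<inter> W) \<psi>)"
    by (rule iffD1[OF smooth_on_cong[OF op], rotated])
       (use chart_inj[OF M U] inj_on_subset[OF chart_inj[OF M U], of "U \<inter> W"] in \<open>auto simp: inv_into_f_f\<close>)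
  with op show "open (\<psi> ` ?S) \<and> smooth_on (\<psi> ` ?S) (\<eta> \<circ> (\<lambda>x. x) \<circ> inv_into (U \<inter> W) \<psi>)" by blast
qed

lemma smooth_manifold_open_sub:
  assumes M: "smooth_manifold M" and W: "openin (mtop M) W"
  shows "smooth_manifold (open_sub M W)"
  unfolding smooth_manifold_def
proof (intro conjI)
  show "Hausdorff_space (mtop (open_sub M W))"
    using M by (simp add: smooth_manifold_def mtop_open_sub Hausdorff_space_subtopology)
  show "second_countable (mtop (open_sub M W))"
    using M by (simp add: smooth_manifold_def mtop_open_sub second_countable_subtopology)
  have "(\<Union>(U, \<psi>)\<in>atlas M. U) = topspace (mtop M)"
    using M by (simp add: smooth_manifold_def)
  then show "(\<Union>(U, \<psi>)\<in>atlas (open_sub M W). U) = topspace (mtop (open_sub M W))"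
    by (auto simp: atlas_open_sub mtop_open_sub case_prod_beta image_image)
  show "\<forall>(U, \<psi>)\<in>atlas (open_sub M W).
      openin (mtop (open_sub M W)) U \<and> open (\<psi> ` U) \<and>
      homeomorphic_map (subtopology (mtop (open_sub M W)) U) (top_of_set (\<psi> ` U)) \<psi>"
    unfolding atlas_open_sub mtop_open_sub
  proof clarify
    fix U \<psi> assume U: "(U, \<psi>) \<in> atlas M"
    note c = smooth_manifold_chart[OF M U]
    have UW: "openin (mtop M) (U \<inter> W)" using c(1) W by blast
    have e: "W \<inter> (U \<inter> W) = U \<inter> W" "U \<inter> (U \<inter> W) = U \<inter> W" "\<psi> ` U \<inter> \<psi> ` (U \<inter> W) = \<psi> ` (U \<inter> W)"
      by auto
    have "homeomorphic_map (subtopology (subtopology (mtop M) U) (U \<inter> W))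
        (subtopology (top_of_set (\<psi> ` U)) (\<psi> ` (U \<inter> W))) \<psi>"
      by (rule homeomorphic_map_subtopologies[OF c(2)])
         (use chart_subset[OF M U] in auto)
    then have "homeomorphic_map (subtopology (subtopology (mtop M) W) (U \<inter> W)) (top_of_set (\<psi> ` (U \<inter> W))) \<psi>"
      by (simp only: subtopology_subtopology e)
    then show "openin (subtopology (mtop M) W) (U \<inter> W) \<and> open (\<psi> ` (U \<inter> W)) \<and>
        homeomorphic_map (subtopology (subtopology (mtop M) W) (U \<inter> W)) (top_of_set (\<psi> ` (U \<inter> W))) \<psi>"
      using UW W chart_open_image[OF M U UW] by (simp add: openin_open_subtopology)
  qed
  have "openin (mtop M) (topspace (mtop M) \<inter> W)"
    using W by (simp add: openin_subset Int_absorb1)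
  note cs = charts_smooth_open_sub[OF M this this]
  show "\<forall>(U, \<psi>)\<in>atlas (open_sub M W). \<forall>(V, \<eta>)\<in>atlas (open_sub M W).
      smooth_on (\<psi> ` (U \<inter> V)) (\<eta> \<circ> inv_into U \<psi>)"
    using charts_smoothD(2)[OF cs] by (auto simp: comp_def)
qed

lemma mtop_euclid [simp]: "mtop euclid = euclidean"
  and atlas_euclid: "atlas euclid = {(UNIV, \<lambda>x. x)}"
  by (simp_all add: euclid_def)

lemma inv_into_ident: "x \<in> S \<Longrightarrow> inv_into S (\<lambda>x. x) x = x"
  using inv_into_f_f[of "\<lambda>x. x" S x] by simp

lemma smooth_manifold_euclid: "smooth_manifold (euclid :: (real^'n, 'n::finite) mfd)"
proof -
  have "second_countable (euclidean :: (real^'n) topology)"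
  proof -
    obtain \<B> :: "(real^'n) set set" where \<B>: "countable \<B>" "\<And>C. C \<in> \<B> \<Longrightarrow> open C"
      "\<And>S. open S \<Longrightarrow> \<exists>U. U \<subseteq> \<B> \<and> S = \<Union>U"
      using univ_second_countable by blast
    show ?thesis
      unfolding second_countable_def
    proof (intro exI[of _ \<B>] conjI ballI allI impI \<B>(1))
      show "openin euclidean V" if "V \<in> \<B>" for V using \<B>(2) that by simp
    next
      fix U :: "(real^'n) set" and x assume "openin euclidean U \<and> x \<in> U"
      then show "\<exists>V\<in>\<B>. x \<in> V \<and> V \<subseteq> U" using \<B>(3)[of U] by auto
    qed
  qed
  then show ?thesis
    by (auto simp: smooth_manifold_def atlas_euclid comp_def inv_into_ident
        homeomorphic_map_id[unfolded id_def] Hausdorff_space_euclidean smooth_on_ident)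
qed

lemma smooth_map_compose:
  assumes "smooth_manifold M" "smooth_manifold N" "smooth_manifold P"
    and "smooth_map M N h" "smooth_map N P k"
  shows "smooth_map M P (k \<circ> h)"
proof -
  have hk: "continuous_map (mtop M) (mtop N) h" "charts_smooth (atlas M) (atlas N) h"
    "continuous_map (mtop N) (mtop P) k" "charts_smooth (atlas N) (atlas P) k"
    using assms smooth_map_iff by blast+
  have "charts_smooth (atlas M) (atlas P) (k \<circ> h)"
  proof (rule charts_smooth_compose[OF hk(2,4)])
    fix U \<psi> p assume "(U, \<psi>) \<in> atlas M" "p \<in> U"
    then have "h p \<in> topspace (mtop N)"
      using chart_subset[OF assms(1)] hk(1) by (auto simp: continuous_map_def)
    then show "\<exists>V \<eta>. (V, \<eta>) \<in> atlas N \<and> h p \<in> V"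
      using chart_cover[OF assms(2)] by metis
  qed (auto intro: chart_inj assms)
  then show ?thesis
    using smooth_map_iff assms hk continuous_map_compose by blast
qed

lemma smooth_map_inclusion:
  assumes M: "smooth_manifold M" and W: "openin (mtop M) W"
  shows "smooth_map (open_sub M W) M (\<lambda>x. x)"
proof -
  have "charts_smooth (atlas (open_sub M W)) (atlas (open_sub M UNIV)) (\<lambda>x. x)"
    by (rule charts_smooth_open_sub[OF M]) (use W in \<open>auto simp: openin_subset Int_absorb1\<close>)
  then show ?thesis
    using smooth_map_iff[OF smooth_manifold_open_sub[OF M W] M]
    by (simp add: mtop_open_sub open_sub_UNIV continuous_map_from_subtopology
        continuous_map_id[unfolded id_def])
qed

lemma smooth_map_into_open_sub:
  assumes M: "smooth_manifold M" and N: "smooth_manifold N" and W: "openin (mtop N) W"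
    and h: "smooth_map M N h" and hW: "h ` topspace (mtop M) \<subseteq> W"
  shows "smooth_map M (open_sub N W) h"
proof -
  note h' = h[unfolded smooth_map_iff[OF M N]]
  have id: "charts_smooth (atlas (open_sub N UNIV)) (atlas (open_sub N W)) (\<lambda>x. x)"
    by (rule charts_smooth_open_sub[OF N]) (use W in \<open>auto simp: openin_subset Int_absorb1\<close>)
  have "charts_smooth (atlas M) (atlas (open_sub N W)) ((\<lambda>x. x) \<circ> h)"
  proof (rule charts_smooth_compose[OF conjunct2[OF h'] id[unfolded open_sub_UNIV]])
    fix U \<psi> p assume "(U, \<psi>) \<in> atlas M" "p \<in> U"
    then have "h p \<in> topspace (mtop N)"
      using chart_subset[OF M] h' by (auto simp: continuous_map_def)
    then show "\<exists>V \<eta>. (V, \<eta>) \<in> atlas N \<and> h p \<in> V"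
      using chart_cover[OF N] by metis
  qed (auto intro: chart_inj M N)
  then show ?thesis
    using smooth_map_iff[OF M smooth_manifold_open_sub[OF N W]] h' hW
    by (auto simp: comp_def mtop_open_sub continuous_map_in_subtopology)
qed

lemma smooth_map_open_sub:
  assumes M: "smooth_manifold M" and N: "smooth_manifold N"
    and h: "smooth_map M N h" and W: "openin (mtop M) W" and V: "openin (mtop N) V" and "h ` W \<subseteq> V"
  shows "smooth_map (open_sub M W) (open_sub N V) h"
proof -
  note MW = smooth_manifold_open_sub[OF M W]
  have "smooth_map (open_sub M W) N (h \<circ> (\<lambda>x. x))"
    by (rule smooth_map_compose[OF MW M N smooth_map_inclusion[OF M W] h])
  then show ?thesis
    using smooth_map_into_open_sub[OF MW N V, of h] assms(6)
    by (auto simp: comp_def mtop_open_sub)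
qed

text \<open>A real function is a map into the line with the identity as its only chart, so
  \<open>charts_smooth_compose\<close> also yields pull-backs of functions.\<close>

lemma smooth_fun_iff:
  assumes "smooth_manifold M"
  shows "smooth_fun M W f \<longleftrightarrow>
    openin (mtop M) W \<and> charts_smooth (atlas (open_sub M W)) {(UNIV, \<lambda>x. x)} f"
proof -
  have *: "open (\<psi> ` (U \<inter> W))" "smooth_on (\<psi> ` (U \<inter> W)) (f \<circ> inv_into U \<psi>) \<longleftrightarrow>
      smooth_on (\<psi> ` (U \<inter> W)) (f \<circ> inv_into (U \<inter> W) \<psi>)"
    if W: "openin (mtop M) W" and U: "(U, \<psi>) \<in> atlas M" for U \<psi>
  proof -
    show op: "open (\<psi> ` (U \<inter> W))"
      using chart_open_image[OF assms U] W smooth_manifold_chart(1)[OF assms U] by blast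
    show "smooth_on (\<psi> ` (U \<inter> W)) (f \<circ> inv_into U \<psi>) \<longleftrightarrow>
        smooth_on (\<psi> ` (U \<inter> W)) (f \<circ> inv_into (U \<inter> W) \<psi>)"
      by (rule smooth_on_cong[OF op])
         (use chart_inj[OF assms U] inj_on_subset[OF chart_inj[OF assms U], of "U \<inter> W"]
           in \<open>auto simp: inv_into_f_f\<close>)
  qed
  have cs: "charts_smooth (atlas (open_sub M W)) {(UNIV, \<lambda>x. x)} f \<longleftrightarrow>
      (\<forall>(U, \<psi>)\<in>atlas M. open (\<psi> ` (U \<inter> W)) \<and>
        smooth_on (\<psi> ` (U \<inter> W)) (f \<circ> inv_into (U \<inter> W) \<psi>))"
    by (simp add: charts_smooth_def atlas_open_sub comp_def case_prod_beta)
  show ?thesis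
    unfolding smooth_fun_def cs
  proof (intro conj_cong refl ball_cong)
    fix c assume "openin (mtop M) W" "c \<in> atlas M"
    then show "(case c of (U, \<psi>) \<Rightarrow> smooth_on (\<psi> ` (U \<inter> W)) (f \<circ> inv_into U \<psi>)) \<longleftrightarrow>
      (case c of (U, \<psi>) \<Rightarrow> open (\<psi> ` (U \<inter> W)) \<and>
        smooth_on (\<psi> ` (U \<inter> W)) (f \<circ> inv_into (U \<inter> W) \<psi>))"
      using * by (cases c) simp
  qed
qed

lemma smooth_fun_compose:
  assumes M: "smooth_manifold M" and N: "smooth_manifold N"
    and h: "smooth_map M N h" and f: "smooth_fun N W f"
  shows "smooth_fun M (topspace (mtop M) \<inter> h -` W) (f \<circ> h)"
proof -
  let ?V = "topspace (mtop M) \<inter> h -` W"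
  have W: "openin (mtop N) W" using f smooth_fun_def by blast
  have "openin (mtop M) {x \<in> topspace (mtop M). h x \<in> W}"
    using h W openin_continuous_map_preimage unfolding smooth_map_def by blast
  then have V: "openin (mtop M) ?V"
    by (simp add: vimage_def Int_def)
  note MV = smooth_manifold_open_sub[OF M V] and NW = smooth_manifold_open_sub[OF N W]
  have h': "smooth_map (open_sub M ?V) (open_sub N W) h"
    by (rule smooth_map_open_sub[OF M N h V W]) auto
  have "charts_smooth (atlas (open_sub M ?V)) {(UNIV, \<lambda>x. x)} (f \<circ> h)"
  proof (rule charts_smooth_compose)
    show "charts_smooth (atlas (open_sub M ?V)) (atlas (open_sub N W)) h"
      using h' smooth_map_iff[OF MV NW] by blast
    show "charts_smooth (atlas (open_sub N W)) {(UNIV, \<lambda>x. x)} f"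
      using f smooth_fun_iff[OF N] by blast
    show "\<exists>V \<eta>. (V, \<eta>) \<in> atlas (open_sub N W) \<and> h p \<in> V"
      if "(U, \<psi>) \<in> atlas (open_sub M ?V)" "p \<in> U" for U \<psi> p
    proof -
      have "h p \<in> topspace (mtop (open_sub N W))"
        using chart_subset[OF MV that(1)] h' that(2) by (auto simp: smooth_map_def continuous_map_def)
      then show ?thesis using chart_cover[OF NW] by metis
    qed
  qed (auto intro: chart_inj MV NW)
  with V show ?thesis using smooth_fun_iff[OF M] by blast
qed

lemma smooth_near_compose:
  assumes "smooth_manifold M" "smooth_manifold N" "smooth_map M N h"
    and "p \<in> topspace (mtop M)" "smooth_near N (h p) f"
  shows "smooth_near M p (f \<circ> h)"
proof -
  obtain W where W: "h p \<in> W" "smooth_fun N W f"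
    using assms(5) unfolding smooth_near_def by (elim exE conjE)
  have "p \<in> topspace (mtop M) \<inter> h -` W" using W assms(4) by simp
  with smooth_fun_compose[OF assms(1-3) W(2)] show ?thesis
    unfolding smooth_near_def by (intro exI conjI)
qed

text \<open>Velocities and differentials test \<open>smooth_near\<close> before they act. The test
  has the same outcome in \<open>W\<close> as in \<open>M\<close>, and hence the tangent vectors are
  the same operators.\<close>

lemma smooth_near_open_sub:
  assumes M: "smooth_manifold M" and W: "openin (mtop M) W" and p: "p \<in> W"
  shows "smooth_near (open_sub M W) p f \<longleftrightarrow> smooth_near M p f"
proof
  assume "smooth_near (open_sub M W) p f"
  then obtain W' where W': "p \<in> W'" "smooth_fun (open_sub M W) W' f"
    unfolding smooth_near_def by blast
  then have "openin (subtopology (mtop M) W) W'" by (simp add: smooth_fun_def mtop_open_sub)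
  then have "openin (mtop M) W'" "W \<inter> W' = W'"
    using openin_open_subtopology[OF W] by auto
  with W' have "smooth_fun M W' f"
    by (simp add: smooth_fun_iff[OF M] smooth_fun_iff[OF smooth_manifold_open_sub[OF M W]] open_sub_open_sub)
  with W' show "smooth_near M p f" unfolding smooth_near_def by blast
next
  assume "smooth_near M p f"
  moreover have "p \<in> topspace (mtop (open_sub M W))"
    using openin_subset[OF W] p by (auto simp: mtop_open_sub)
  ultimately show "smooth_near (open_sub M W) p f"
    using smooth_near_compose[OF smooth_manifold_open_sub[OF M W] M smooth_map_inclusion[OF M W]]
    by (simp add: comp_def)
qed

lemma smooth_fun_euclid: "smooth_fun euclid W f \<longleftrightarrow> open W \<and> smooth_on W f"
  by (simp add: smooth_fun_def atlas_euclid comp_def inv_into_ident)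

lemma smooth_near_euclid_differentiable: "smooth_near euclid q f \<Longrightarrow> f differentiable (at q)"
  unfolding smooth_near_def smooth_fun_euclid using smooth_on_imp_differentiable by blast

lemma smooth_near_euclid_linear: "linear f \<Longrightarrow> smooth_near euclid q f"
  unfolding smooth_near_def smooth_fun_euclid using smooth_on_linear by blast

lemma smooth_map_euclid:
  assumes "open S" "open T"
  shows "smooth_map (open_sub euclid S) (open_sub euclid T) f \<longleftrightarrow> smooth_on S f \<and> f ` S \<subseteq> T"
proof -
  have "smooth_on S (f \<circ> inv_into S (\<lambda>x. x)) \<longleftrightarrow> smooth_on S f"
    by (rule smooth_on_cong[OF assms(1)]) (simp add: inv_into_ident)
  moreover have "S \<inter> f -` T = S" if "f \<in> S \<rightarrow> T" using that by auto
  ultimately show ?thesis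
    by (cases "f \<in> S \<rightarrow> T") (auto simp: smooth_map_def atlas_open_sub atlas_euclid mtop_open_sub comp_def
       continuous_map_in_subtopology smooth_on_imp_continuous_on)
qed

section \<open>Tangent vectors in coordinates\<close>

text \<open>The parameter interval with the identity is an atlas of one chart, so curves fall under
  \<open>charts_smooth_compose\<close> just as maps do. For this the chart sets there may take
  values in any Euclidean space, in particular in the reals.\<close>

lemma smooth_curve_at_compose:
  assumes M: "smooth_manifold M" and N: "smooth_manifold N"
    and c: "smooth_curve_at M p c" and h: "smooth_map M N h"
  shows "smooth_curve_at N (h p) (h \<circ> c)"
proof -
  obtain e where e: "c 0 = p" "e > 0" "continuous_map (top_of_set {-e<..<e}) (mtop M) c"
    "\<And>U \<psi>. (U, \<psi>) \<in> atlas M \<Longrightarrow> smooth_on ({-e<..<e} \<inter> c -` U) (\<psi> \<circ> c)"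
    using c unfolding smooth_curve_at_def by blast
  let ?I = "{-e<..<e}"
  have h': "continuous_map (mtop M) (mtop N) h" "charts_smooth (atlas M) (atlas N) h"
    using h smooth_map_iff[OF M N] by auto
  have "charts_smooth {(?I, \<lambda>x. x)} (atlas M) c"
    unfolding charts_smooth_def
  proof clarsimp
    fix U \<psi> assume U: "(U, \<psi>) \<in> atlas M"
    have "openin (top_of_set ?I) {t \<in> topspace (top_of_set ?I). c t \<in> U}"
      by (rule openin_continuous_map_preimage[OF e(3) smooth_manifold_chart(1)[OF M U]])
    moreover have "{t \<in> topspace (top_of_set ?I). c t \<in> U} = ?I \<inter> c -` U" by auto
    ultimately have op: "open (?I \<inter> c -` U)"
      using openin_open_trans open_greaterThanLessThan by metis
    moreover have "smooth_on (?I \<inter> c -` U) (\<psi> \<circ> c \<circ> inv_into ?I (\<lambda>x. x))"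
      by (rule iffD1[OF smooth_on_cong[OF op] e(4)[OF U]]) (simp add: inv_into_ident)
    ultimately show "open (?I \<inter> c -` U) \<and> smooth_on (?I \<inter> c -` U) (\<psi> \<circ> c \<circ> inv_into ?I (\<lambda>x. x))" ..
  qed
  then have hc: "charts_smooth {(?I, \<lambda>x. x)} (atlas N) (h \<circ> c)"
  proof (rule charts_smooth_compose[OF _ h'(2)])
    fix U \<psi> t assume "(U, \<psi>) \<in> {(?I, \<lambda>x. x)}" "t \<in> U"
    then have "c t \<in> topspace (mtop M)" using e(3) by (auto simp: continuous_map_def)
    then show "\<exists>V \<eta>. (V, \<eta>) \<in> atlas M \<and> c t \<in> V"
      using chart_cover[OF M] by metis
  qed (auto intro: chart_inj M)
  have "smooth_on (?I \<inter> (h \<circ> c) -` V) (\<eta> \<circ> (h \<circ> c))" if V: "(V, \<eta>) \<in> atlas N" for V \<eta>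
  proof -
    note * = charts_smoothD[OF hc singletonI V, unfolded image_ident]
    show ?thesis
      by (rule iffD1[OF smooth_on_cong[OF *(1)] *(2)]) (simp add: inv_into_ident)
  qed
  then show ?thesis
    unfolding smooth_curve_at_def using e(1,2) continuous_map_compose[OF e(3) h'(1)] by auto
qed

text \<open>The radius in \<open>smooth_curve_at\<close> is existential: a curve that leaves
  \<open>W\<close> later is confined to it by shrinking the interval, with the new radius supplied
  by continuity.\<close>

lemma smooth_curve_at_open_sub:
  assumes M: "smooth_manifold M" and W: "openin (mtop M) W" and p: "p \<in> W"
  shows "smooth_curve_at (open_sub M W) p c \<longleftrightarrow> smooth_curve_at M p c"
proof
  assume "smooth_curve_at (open_sub M W) p c"
  then show "smooth_curve_at M p c"
    using smooth_curve_at_compose[OF smooth_manifold_open_sub[OF M W] M _ smooth_map_inclusion[OF M W], of p c]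
    by (simp add: comp_def)
next
  assume "smooth_curve_at M p c"
  then obtain e where e: "c 0 = p" "e > 0" "continuous_map (top_of_set {-e<..<e}) (mtop M) c"
    "\<And>U \<psi>. (U, \<psi>) \<in> atlas M \<Longrightarrow> smooth_on ({-e<..<e} \<inter> c -` U) (\<psi> \<circ> c)"
    unfolding smooth_curve_at_def by blast
  let ?I = "{-e<..<e}"
  have "openin (top_of_set ?I) {t \<in> topspace (top_of_set ?I). c t \<in> W}"
    by (rule openin_continuous_map_preimage[OF e(3) W])
  then have "open {t \<in> ?I. c t \<in> W}"
    using openin_open_trans open_greaterThanLessThan by fastforce
  moreover have "0 \<in> {t \<in> ?I. c t \<in> W}" using e(1,2) p by auto
  ultimately obtain d where d: "d > 0" "ball 0 d \<subseteq> {t \<in> ?I. c t \<in> W}"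
    using open_contains_ball by blast
  have b: "{-d<..<d} = ball 0 d" by (auto simp: dist_norm)
  have sub: "{-d<..<d} \<subseteq> ?I" "c ` {-d<..<d} \<subseteq> W" unfolding b using d(2) by auto
  have "continuous_map (top_of_set {-d<..<d}) (mtop M) c"
    by (rule continuous_map_from_subtopology_mono[OF e(3) sub(1)])
  then have "continuous_map (top_of_set {-d<..<d}) (mtop (open_sub M W)) c"
    using sub(2) by (auto simp: mtop_open_sub continuous_map_in_subtopology)
  moreover have "smooth_on ({-d<..<d} \<inter> c -` (U \<inter> W)) (\<psi> \<circ> c)" if "(U, \<psi>) \<in> atlas M" for U \<psi>
    by (rule smooth_on_subset[OF e(4)[OF that]]) (use sub(1) in auto)
  ultimately show "smooth_curve_at (open_sub M W) p c"
    using d(1) e(1) unfolding smooth_curve_at_def atlas_open_sub by auto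
qed

lemma tangent_space_open_sub:
  assumes M: "smooth_manifold M" and W: "openin (mtop M) W" and p: "p \<in> W"
  shows "tangent_space (open_sub M W) p = tangent_space M p"
proof -
  have "velocity (open_sub M W) c = velocity M c" if "smooth_curve_at M p c" for c
    using that p by (simp add: smooth_curve_at_def velocity_def smooth_near_open_sub[OF M W])
  then show ?thesis
    by (simp add: tangent_space_def smooth_curve_at_open_sub[OF M W p] cong: image_cong_simp)
qed

lemma deriv_along_curve:
  fixes f :: "'v::euclidean_space \<Rightarrow> real"
  assumes "f differentiable (at (\<gamma> 0))" "(\<gamma> has_vector_derivative a) (at 0)"
  shows "deriv (f \<circ> \<gamma>) 0 = frechet_derivative f (at (\<gamma> 0)) a"
proof -
  let ?D = "frechet_derivative f (at (\<gamma> 0))"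
  have D: "(f has_derivative ?D) (at (\<gamma> 0))" using assms(1) frechet_derivative_works by blast
  have "((f \<circ> \<gamma>) has_derivative (\<lambda>t. ?D (t *\<^sub>R a))) (at 0)"
    using diff_chain_at[OF assms(2)[unfolded has_vector_derivative_def] D] by (simp add: comp_def)
  moreover have "(\<lambda>t. ?D (t *\<^sub>R a)) = (*) (?D a)"
    using linear_cmul[OF has_derivative_linear[OF D]] by (auto simp: mult.commute)
  ultimately show ?thesis
    by (intro DERIV_imp_deriv) (simp add: has_field_derivative_def)
qed

text \<open>The image of the vector \<open>a\<close> at \<open>q\<close> under the differential of
  \<open>\<phi>\<close>, as an operator on functions with the same default 0 as
  \<open>velocity\<close>. Since \<open>\<phi>\<close> is an arbitrary function, the notion covers
  composites with a further map as well.\<close>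

definition tvec ::
  "('a, 'n::finite) mfd \<Rightarrow> (real^'m::finite \<Rightarrow> 'a) \<Rightarrow> real^'m \<Rightarrow> real^'m \<Rightarrow> 'a tangent" where
  "tvec M \<phi> q a =
     (\<lambda>F. if smooth_near M (\<phi> q) F then frechet_derivative (F \<circ> \<phi>) (at q) a else 0)"

lemma frechet_derivative_vec_nth:
  fixes f :: "'a::euclidean_space \<Rightarrow> real^'n"
  assumes "f differentiable (at q)"
  shows "frechet_derivative (\<lambda>x. f x $ i) (at q) a = frechet_derivative f (at q) a $ i"
proof -
  have "((\<lambda>x. f x $ i) has_derivative (\<lambda>a. frechet_derivative f (at q) a $ i)) (at q)"
    using assms by (intro bounded_linear.has_derivative[OF bounded_linear_vec_nth])
      (simp flip: frechet_derivative_works)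
  then show ?thesis using frechet_derivative_at by metis
qed

lemma components_tvec:
  fixes f :: "real^'m \<Rightarrow> real^'n"
  assumes "open V" "f q \<in> V" "f differentiable (at q)"
  shows "components (tvec (open_sub euclid V) f q a) = frechet_derivative f (at q) a"
proof -
  have "smooth_near (open_sub euclid V) (f q) (\<lambda>x. x $ i)" for i
    using assms(1,2) smooth_near_open_sub[OF smooth_manifold_euclid, of V "f q"]
    by (simp add: smooth_near_euclid_linear linear_iff)
  then show ?thesis
    using frechet_derivative_vec_nth[OF assms(3)]
    by (simp add: components_def tvec_def vec_eq_iff comp_def)
qed

text \<open>This is the chain rule. What has to be checked is that \<open>F \<circ> h\<close> does
  not run into the default value of \<open>tvec\<close>: \<open>h\<close> is smooth on
  \<open>W\<close> only, but smoothness near a point is local.\<close>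

lemma differential_tvec:
  assumes M: "smooth_manifold M" and W: "openin (mtop M) W" and q: "\<phi> q \<in> W"
    and N: "smooth_manifold N" and h: "smooth_map (open_sub M W) N h"
  shows "differential N h (\<phi> q) (tvec M \<phi> q a) = tvec N (h \<circ> \<phi>) q a"
proof
  fix F
  have "smooth_near M (\<phi> q) (F \<circ> h)" if "smooth_near N (h (\<phi> q)) F"
    using smooth_near_compose[OF smooth_manifold_open_sub[OF M W] N h _ that]
      smooth_near_open_sub[OF M W q] openin_subset[OF W] q
    by (auto simp: mtop_open_sub)
  then show "differential N h (\<phi> q) (tvec M \<phi> q a) F = tvec N (h \<circ> \<phi>) q a F"
    by (simp add: differential_def tvec_def comp_assoc)
qed

lemma topspace_open_sub: "openin (mtop M) W \<Longrightarrow> topspace (mtop (open_sub M W)) = W"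
  by (simp add: mtop_open_sub openin_subset Int_absorb1)

text \<open>A coordinate system with its image \<open>W\<close> and inverse \<open>k\<close> made
  explicit. It is interpreted for the inverse of an isometry, for a given coordinate system, and for
  the latter cut down to a smaller domain.\<close>

locale coordinates =
  fixes M :: "('a, 'n::finite) mfd" and D :: "(real^'n) set" and W :: "'a set"
    and \<phi> :: "real^'n \<Rightarrow> 'a" and k :: "'a \<Rightarrow> real^'n"
  assumes M: "smooth_manifold M" and D: "open D" and W: "openin (mtop M) W"
    and \<phi>: "smooth_map (open_sub euclid D) (open_sub M W) \<phi>"
    and k: "smooth_map (open_sub M W) (open_sub euclid D) k"
    and k\<phi>: "q \<in> D \<Longrightarrow> k (\<phi> q) = q"
    and \<phi>k: "p \<in> W \<Longrightarrow> \<phi> (k p) = p"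
begin

lemma E: "smooth_manifold (euclid :: (real^'n, 'n) mfd)" "openin (mtop euclid) D"
  using smooth_manifold_euclid D by auto

lemmas ED = smooth_manifold_open_sub[OF E]
lemmas MW = smooth_manifold_open_sub[OF M W]

lemma \<phi>_in: "q \<in> D \<Longrightarrow> \<phi> q \<in> W"
  using \<phi> topspace_open_sub[OF E(2)] topspace_open_sub[OF W]
  by (auto simp: smooth_map_def continuous_map_def)

lemma k_in: "p \<in> W \<Longrightarrow> k p \<in> D"
  using k topspace_open_sub[OF E(2)] topspace_open_sub[OF W]
  by (auto simp: smooth_map_def continuous_map_def)

lemma \<phi>_M: "smooth_map (open_sub euclid D) M \<phi>"
  using smooth_map_compose[OF ED MW M \<phi> smooth_map_inclusion[OF M W]] by (simp add: comp_def)

lemma smooth_near_pullback: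
  assumes "q \<in> D" "smooth_near M (\<phi> q) F"
  shows "smooth_near euclid q (F \<circ> \<phi>)"
  using smooth_near_compose[OF ED M \<phi>_M _ assms(2)] assms(1)
  by (simp add: topspace_open_sub[OF E(2)] smooth_near_open_sub[OF E])

lemma linear_tvec: "q \<in> D \<Longrightarrow> linear (tvec M \<phi> q)"
proof -
  assume q: "q \<in> D"
  have "linear (frechet_derivative (F \<circ> \<phi>) (at q))" if "smooth_near M (\<phi> q) F" for F
    using smooth_near_euclid_differentiable[OF smooth_near_pullback[OF q that]]
    by (rule linear_frechet_derivative)
  then show ?thesis
    unfolding linear_iff
    by (auto simp: tvec_def fun_eq_iff plus_fun_def scaleR_fun_def linear_add linear_cmul)
qed

text \<open>A curve through \<open>\<phi> q\<close> is carried by \<open>k\<close> to a curve in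
  \<open>D\<close>, whose derivative at 0 is the vector sought; conversely every vector
  \<open>a\<close> is realised by the image under \<open>\<phi>\<close> of the straight line through
  \<open>q\<close> in direction \<open>a\<close>.\<close>

lemma tangent_space_eq:
  assumes q: "q \<in> D"
  shows "tangent_space M (\<phi> q) = range (tvec M \<phi> q)"
proof (intro equalityI subsetI)
  fix v assume "v \<in> tangent_space M (\<phi> q)"
  then obtain c where c: "smooth_curve_at M (\<phi> q) c" "v = velocity M c"
    unfolding tangent_space_def by blast
  then have cW: "smooth_curve_at (open_sub M W) (\<phi> q) c"
    by (simp add: smooth_curve_at_open_sub[OF M W] \<phi>_in q)
  then obtain e where e: "c 0 = \<phi> q" "e > 0" "continuous_map (top_of_set {-e<..<e}) (mtop (open_sub M W)) c"
    unfolding smooth_curve_at_def by blast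
  have cin: "c t \<in> W" if "t \<in> {-e<..<e}" for t
    using e(3) that by (auto simp: continuous_map_def topspace_open_sub[OF W])
  define \<gamma> where "\<gamma> = k \<circ> c"
  have "smooth_curve_at (open_sub euclid D) (k (\<phi> q)) \<gamma>"
    unfolding \<gamma>_def by (rule smooth_curve_at_compose[OF MW ED cW k])
  then have \<gamma>: "smooth_curve_at euclid q \<gamma>"
    using q by (simp add: k\<phi> smooth_curve_at_open_sub[OF E])
  then obtain d where "\<gamma> 0 = q" "d > 0" "smooth_on {-d<..<d} \<gamma>"
    by (auto simp: smooth_curve_at_def atlas_euclid comp_def)
  then have \<gamma>0: "\<gamma> 0 = q" and "\<gamma> differentiable (at 0)"
    using smooth_on_imp_differentiable[of "{-d<..<d}" \<gamma> 0] by auto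
  then obtain a where a: "(\<gamma> has_vector_derivative a) (at 0)"
    using vector_derivative_works by blast
  have "velocity M c = tvec M \<phi> q a"
  proof
    fix F
    show "velocity M c F = tvec M \<phi> q a F"
    proof (cases "smooth_near M (\<phi> q) F")
      case True
      \<comment> \<open>\<open>\<phi> \<circ> k\<close> is known to be the identity on
        \<open>W\<close>, and \<open>c\<close> to stay in \<open>W\<close> for parameters near 0;
        the derivative at 0 sees no more than that.\<close>
      have "deriv (F \<circ> c) 0 = deriv ((F \<circ> \<phi>) \<circ> \<gamma>) 0"
      proof (rule deriv_cong_ev[OF _ refl])
        have "eventually (\<lambda>t. t \<in> {-e<..<e}) (nhds 0)"
          using e(2) by (intro eventually_nhds_in_open) auto
        then show "eventually (\<lambda>t. (F \<circ> c) t = (F \<circ> \<phi> \<circ> \<gamma>) t) (nhds 0)"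
          by eventually_elim (simp add: \<gamma>_def \<phi>k cin)
      qed
      also have "\<dots> = frechet_derivative (F \<circ> \<phi>) (at q) a"
        using deriv_along_curve[OF _ a, of "F \<circ> \<phi>"]
          smooth_near_euclid_differentiable[OF smooth_near_pullback[OF q True]] \<gamma>0 by simp
      finally show ?thesis using True e(1) by (simp add: velocity_def tvec_def)
    qed (simp add: velocity_def tvec_def e(1))
  qed
  with c(2) show "v \<in> range (tvec M \<phi> q)" by blast
next
  fix v assume "v \<in> range (tvec M \<phi> q)"
  then obtain a where v: "v = tvec M \<phi> q a" by blast
  let ?\<gamma> = "\<lambda>t::real. q + t *\<^sub>R a"
  have der: "(?\<gamma> has_vector_derivative a) (at t)" for t
    by (auto intro!: derivative_eq_intros)
  have "smooth_on {-1<..<1} ?\<gamma>"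
    unfolding smooth_on_def
    by (intro allI C_k_on_add C_k_on_const C_k_on_linear) (auto simp: linear_iff algebra_simps)
  then have "smooth_curve_at euclid q ?\<gamma>"
    unfolding smooth_curve_at_def
    by (intro conjI exI[of _ 1]) (auto simp: atlas_euclid comp_def intro!: continuous_intros)
  then have "smooth_curve_at (open_sub euclid D) q ?\<gamma>"
    using q by (simp add: smooth_curve_at_open_sub[OF E])
  then have c: "smooth_curve_at M (\<phi> q) (\<phi> \<circ> ?\<gamma>)"
    by (rule smooth_curve_at_compose[OF ED M _ \<phi>_M])
  moreover have "velocity M (\<phi> \<circ> ?\<gamma>) = tvec M \<phi> q a"
  proof
    fix F
    have "deriv (F \<circ> \<phi> \<circ> ?\<gamma>) 0 = frechet_derivative (F \<circ> \<phi>) (at q) a" if "smooth_near M (\<phi> q) F"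
      using deriv_along_curve[OF _ der, of "F \<circ> \<phi>"]
        smooth_near_euclid_differentiable[OF smooth_near_pullback[OF q that]] by simp
    then show "velocity M (\<phi> \<circ> ?\<gamma>) F = tvec M \<phi> q a F"
      by (simp add: velocity_def tvec_def comp_assoc)
  qed
  ultimately show "v \<in> tangent_space M (\<phi> q)"
    unfolding v tangent_space_def by (metis image_eqI mem_Collect_eq)
qed

lemma differential_coord_vector:
  assumes q: "q \<in> D"
  shows "differential M \<phi> q (coord_vector q i) = tvec M \<phi> q (axis i 1)"
proof
  fix F
  let ?\<gamma> = "\<lambda>t::real. q + t *\<^sub>R axis i 1"
  have der: "(?\<gamma> has_vector_derivative axis i 1) (at t)" for t
    by (auto intro!: derivative_eq_intros)
  have "deriv (F \<circ> \<phi> \<circ> ?\<gamma>) 0 = frechet_derivative (F \<circ> \<phi>) (at q) (axis i 1)"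
    if "smooth_near M (\<phi> q) F"
    using deriv_along_curve[OF _ der, of "F \<circ> \<phi>"]
      smooth_near_euclid_differentiable[OF smooth_near_pullback[OF q that]] by simp
  then show "differential M \<phi> q (coord_vector q i) F = tvec M \<phi> q (axis i 1) F"
    using smooth_near_pullback[OF q]
    by (simp add: differential_def coord_vector_def velocity_def tvec_def)
qed

lemma metric_coeff_eq:
  "q \<in> D \<Longrightarrow> metric_coeff M g \<phi> i j l q =
     g (\<phi> q) (tvec M \<phi> q (axis i 1)) (tvec M \<phi> q (axis j 1)) (tvec M \<phi> q (axis l 1))"
  by (simp add: metric_coeff_def differential_coord_vector)

text \<open>\<open>k \<circ> \<phi>\<close> is the identity on the open set \<open>D\<close>, hence
  so is its derivative. If \<open>k\<close> is an isometry onto an open set, this evaluates its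
  differential on coordinate vectors; in general it gives \<open>inj_tvec\<close>.\<close>

lemma components_differential_inverse:
  assumes q: "q \<in> D"
  shows "components (differential (open_sub euclid D) k (\<phi> q) (tvec M \<phi> q a)) = a"
proof -
  have id: "((\<lambda>x. x) has_derivative (\<lambda>x. x)) (at q)" by (rule has_derivative_ident)
  have "((k \<circ> \<phi>) has_derivative (\<lambda>x. x)) (at q)"
    by (rule has_derivative_transform_within_open[OF id D q]) (simp add: k\<phi>)
  then have "k \<circ> \<phi> differentiable (at q)" "frechet_derivative (k \<circ> \<phi>) (at q) = (\<lambda>x. x)"
    by (auto simp: differentiable_def simp flip: frechet_derivative_at)
  then show ?thesis
    using differential_tvec[where \<phi> = \<phi>, OF M W \<phi>_in[OF q] ED k] components_tvec[OF D, of "k \<circ> \<phi>" q] q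
    by (simp add: k\<phi>)
qed

lemma inj_tvec: "q \<in> D \<Longrightarrow> inj (tvec M \<phi> q)"
  by (metis components_differential_inverse injI)

text \<open>Provides coordinates on the smaller set where a solution becomes invertible. The image
  of \<open>D'\<close> is open because it is the preimage of \<open>D'\<close> under
  \<open>k\<close>.\<close>

lemma restrict:
  assumes D': "open D'" "D' \<subseteq> D"
  shows "coordinates M D' (\<phi> ` D') \<phi> k"
proof -
  have eq: "\<phi> ` D' = {p \<in> topspace (mtop (open_sub M W)). k p \<in> D'}"
    using D'(2) \<phi>_in \<phi>k k\<phi> by (force simp: topspace_open_sub[OF W])
  have "openin (mtop (open_sub euclid D)) D'"
    using D' D by (auto simp: mtop_open_sub openin_open_eq)
  then have op: "openin (mtop (open_sub M W)) (\<phi> ` D')"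
    unfolding eq using k by (intro openin_continuous_map_preimage) (auto simp: smooth_map_def)
  have sub: "D \<inter> D' = D'" "W \<inter> \<phi> ` D' = \<phi> ` D'" using D' \<phi>_in by auto
  have "smooth_map (open_sub (open_sub euclid D) D') (open_sub (open_sub M W) (\<phi> ` D')) \<phi>"
    by (rule smooth_map_open_sub[OF ED MW \<phi> _ op])
       (use D' D in \<open>auto simp: mtop_open_sub openin_open_eq\<close>)
  moreover have "smooth_map (open_sub (open_sub M W) (\<phi> ` D')) (open_sub (open_sub euclid D) D') k"
    by (rule smooth_map_open_sub[OF MW ED k op])
       (use D' D k\<phi> in \<open>auto simp: mtop_open_sub openin_open_eq subset_iff\<close>)
  moreover have "openin (mtop M) (\<phi> ` D')"
    using op openin_open_subtopology[OF W] by (simp add: mtop_open_sub)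
  ultimately show ?thesis
    using M D' k\<phi> by unfold_locales (auto simp: open_sub_open_sub sub subset_iff)
qed

end

section \<open>2-inner products in dimension 3\<close>

text \<open>Positivity is reduced to its consequence \<open>G u v u = 0\<close>. The remaining
  conditions survive differences, so equality of two forms becomes vanishing of one, and they admit
  pull-backs under degenerate linear maps, as required while the injectivity of Df is still open.
  The exchange law \<open>G u u v = G v v u\<close> alone ties the third argument to the
  others.\<close>

definition two_form :: "('v::real_vector \<Rightarrow> 'v \<Rightarrow> 'v \<Rightarrow> real) \<Rightarrow> bool" where
  "two_form G \<longleftrightarrow>
     (\<forall>v w. linear (\<lambda>u. G u v w)) \<and> (\<forall>u v w. G u v w = G v u w) \<and>
     (\<forall>u v. G u u v = G v v u) \<and> (\<forall>u v. G u v u = 0)"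

lemma two_form_simps:
  assumes "two_form G"
  shows "G (a + b) v w = G a v w + G b v w" "G v (a + b) w = G v a w + G v b w"
    "G (r *\<^sub>R a) v w = r * G a v w" "G v (r *\<^sub>R a) w = r * G v a w"
    "G 0 v w = 0" "G u v u = 0" "G v u u = 0"
proof -
  have lin: "linear (\<lambda>u. G u v w)" and sym: "G u v w = G v u w" for u v w
    using assms by (auto simp: two_form_def)
  show "G (a + b) v w = G a v w + G b v w" "G (r *\<^sub>R a) v w = r * G a v w" "G 0 v w = 0"
    using linear_add[OF lin] linear_cmul[OF lin] linear_0[OF lin] by simp_all
  show "G v (a + b) w = G v a w + G v b w" "G v (r *\<^sub>R a) w = r * G v a w"
    using linear_add[OF lin] linear_cmul[OF lin] sym[of v] by simp_all
  show "G u v u = 0" "G v u u = 0" using assms sym[of v u] by (auto simp: two_form_def)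
qed

text \<open>\<open>G (t *\<^sub>R u + v) (t *\<^sub>R u + v) u\<close> is affine in \<open>t\<close>
  with slope \<open>2 * G u v u\<close>, since the quadratic coefficient is
  \<open>G u u u = 0\<close>. A nonnegative affine function has slope 0.\<close>

lemma two_formI:
  assumes lin: "\<And>v w. linear (\<lambda>u. G u v w)" and sym: "\<And>u v w. G u v w = G v u w"
    and swap: "\<And>u v. G u u v = G v v u" and pos: "\<And>u v. G u u v \<ge> (0::real)" and "\<And>u. G u u u = 0"
  shows "two_form G"
proof -
  have "G u v u = 0" for u v
  proof (rule ccontr)
    assume nz: "G u v u \<noteq> 0"
    \<comment> \<open>The parameter at which the affine function takes the value -1.\<close>
    let ?t = "- (G v v u + 1) / (2 * G u v u)"
    have "G (t *\<^sub>R u + v) (t *\<^sub>R u + v) u = 2 * t * G u v u + G v v u" for t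
    proof -
      have add: "G (t *\<^sub>R u + v) w u = t * G u w u + G v w u" for w
        by (simp add: linear_add[OF lin] linear_cmul[OF lin])
      have "G u (t *\<^sub>R u + v) u = G u v u" "G v (t *\<^sub>R u + v) u = t * G u v u + G v v u"
        using add[of u] add[of v] sym[of u "t *\<^sub>R u + v" u] sym[of v "t *\<^sub>R u + v" u]
          sym[of v u u] assms(5)[of u] by simp_all
      with add[of "t *\<^sub>R u + v"] show ?thesis by simp
    qed
    then have "G (?t *\<^sub>R u + v) (?t *\<^sub>R u + v) u = 2 * ?t * G u v u + G v v u" .
    also have "\<dots> = - 1" using nz by (simp add: field_simps)
    finally show False using pos[of "?t *\<^sub>R u + v" u] by simp
  qed
  then show ?thesis using lin sym swap by (auto simp: two_form_def)
qed

lemma exhaust_distinct_3: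
  fixes i j l :: 3
  assumes "i \<noteq> j" "i \<noteq> l" "j \<noteq> l"
  shows "m = i \<or> m = j \<or> m = l"
  using exhaust_3[of i] exhaust_3[of j] exhaust_3[of l] exhaust_3[of m] assms by metis

lemma ex_third_3: "\<exists>l::3. l \<noteq> i \<and> l \<noteq> j"
proof -
  have "card {i, j} < card (UNIV :: 3 set)" by (simp add: card_insert_if)
  then have "{i, j} \<noteq> UNIV" by (metis less_irrefl)
  then show ?thesis by blast
qed

lemma bilinear_vec_eq_0:
  fixes B :: "real^'n \<Rightarrow> real^'n \<Rightarrow> real"
  assumes "bilinear B" "\<And>i j. B (axis i 1) (axis j 1) = 0"
  shows "B x y = 0"
proof -
  have "B = (\<lambda>x y. 0)"
    by (rule bilinear_eq_stdbasis[OF assms(1)])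
       (use assms(2) in \<open>auto simp: Basis_vec_def bilinear_def linear_iff\<close>)
  then show ?thesis by simp
qed

lemma two_form_bilinear: "two_form G \<Longrightarrow> bilinear (\<lambda>u v. G u v w)"
  by (simp add: bilinear_def linear_iff two_form_simps)

text \<open>A 2-inner product is the algebraic curvature tensor \<open>R(u, w, v, w)\<close> in disguise; in dimension 3
  all components of such a tensor have this shape up to symmetry, which fails from dimension 4 on.\<close>

lemma two_form_eq_0:
  fixes G :: "real^3 \<Rightarrow> real^3 \<Rightarrow> real^3 \<Rightarrow> real"
  assumes G: "two_form G" and 0: "\<And>i j k. G (axis i 1) (axis j 1) (axis k 1) = 0"
  shows "G x y z = 0"
proof -
  note s = two_form_simps[OF G]
  have sym: "G u v w = G v u w" and swap: "G u u v = G v v u" for u v w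
    using G by (auto simp: two_form_def)
  let ?e = "\<lambda>i::3. axis i (1::real) :: real^3"
  have ek: "G u v (?e k) = 0" for u v k
    by (rule bilinear_vec_eq_0[OF two_form_bilinear[OF G] 0])
  have ee: "G (?e k) (?e k) w = 0" for k w
    using swap[of "?e k" w] ek by simp
  \<comment> \<open>Three applications of \<open>p i l j = - p l j i\<close> rotate the indices back, so \<open>p = - p\<close>.\<close>
  define p where "p i l j = G (?e i) (?e l) (?e i + ?e j)" for i l j
  have p: "p i l j = - p l j i" if "i \<noteq> j" "i \<noteq> l" "j \<noteq> l" for i j l
  proof -
    let ?a = "?e i + ?e j" and ?b = "?e i + ?e l"
    \<comment> \<open>\<open>?a\<close> is rewritten as \<open>?b\<close> plus a difference of basis
      vectors. Terms with \<open>?b\<close> in one of the first two places vanish, squares vanish by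
      \<open>ee\<close>, and only the cross term is left. Exchanging \<open>?a\<close> and
      \<open>?b\<close> then relates two values of \<open>p\<close>.\<close>
    have "G (?b + ?e j + (-1) *\<^sub>R ?e l) (?b + ?e j + (-1) *\<^sub>R ?e l) ?b = - 2 * G (?e j) (?e l) ?b"
      unfolding s(1)[of "?b + ?e j"] s(2)[of _ "?b + ?e j"] s(1)[of ?b "?e j"] s(2)[of _ ?b "?e j"]
      by (simp only: s(3,4,6,7) ee sym[of "?e l" "?e j"])
    moreover have "?b + ?e j + (-1) *\<^sub>R ?e l = ?a" by simp
    ultimately have "G ?a ?a ?b = - 2 * G (?e j) (?e l) ?b" by simp
    moreover have "G ?b ?b ?a = 2 * p i l j"
      unfolding s(1)[of "?e i" "?e l"] s(2)[of _ "?e i" "?e l"]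
      by (simp add: ee p_def sym[of "?e l" "?e i"])
    ultimately have "p i l j = - G (?e l) (?e j) (?e l + ?e i)"
      using swap[of ?a ?b] sym[of "?e j" "?e l"] by (simp add: add.commute)
    then show ?thesis by (simp add: p_def)
  qed
  have p0: "p i l j = 0" if "i \<noteq> j" "i \<noteq> l" "j \<noteq> l" for i j l
    using p[OF that] p[OF that(2)[symmetric] that(3)[symmetric] that(1)]
      p[OF that(3) that(1)[symmetric] that(2)[symmetric]] by linarith
  have a0: "G x y (?e i + ?e j) = 0" if "i \<noteq> j" for x y i j
  proof (rule bilinear_vec_eq_0[OF two_form_bilinear[OF G]])
    let ?a = "?e i + ?e j"
    obtain l where l: "l \<noteq> i" "l \<noteq> j"
      using ex_third_3 by blast
    have il: "G (?e i) (?e l) ?a = 0" using p0[of i j l] that l by (simp add: p_def)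
    have jl: "G (?e j) (?e l) ?a = 0" using p0[of j i l] that l by (simp add: p_def add.commute)
    have ij: "G (?e i) (?e j) ?a = 0"
      using s(7)[of "?e i" ?a] s(2)[of "?e i" "?e i" "?e j" ?a] ee by simp
    \<comment> \<open>Dimension 3 enters here: \<open>i\<close>, \<open>j\<close> and one further
      index exhaust the basis. With a fourth index, components with \<open>m\<close>,
      \<open>n\<close>, \<open>i\<close>, \<open>j\<close> all distinct would remain.\<close>
    show "G (?e m) (?e n) ?a = 0" for m n
      using exhaust_distinct_3[of i j l m] exhaust_distinct_3[of i j l n] that l ee il jl ij
        sym[of "?e l" "?e i"] sym[of "?e l" "?e j"] sym[of "?e j" "?e i"] by auto
  qed
  \<comment> \<open>The exchange law moves the sum of two basis vectors into the third place, where
    \<open>a0\<close> applies; polarisation then frees the mixed term for arbitrary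
    \<open>z\<close>.\<close>
  have "G (?e i) (?e j) z = 0" for i j
  proof (cases "i = j")
    case False
    have "G (?e i + ?e j) (?e i + ?e j) z = 2 * G (?e i) (?e j) z"
      unfolding s(1)[of "?e i" "?e j"] s(2)[of _ "?e i" "?e j"] by (simp add: ee sym[of "?e j" "?e i"])
    then show ?thesis using swap[of "?e i + ?e j" z] a0[OF False] by simp
  qed (simp add: ee)
  then show ?thesis by (rule bilinear_vec_eq_0[OF two_form_bilinear[OF G]])
qed

lemma two_form_eqI:
  fixes G H :: "real^3 \<Rightarrow> real^3 \<Rightarrow> real^3 \<Rightarrow> real"
  assumes "two_form G" "two_form H"
    and "\<And>i j k. G (axis i 1) (axis j 1) (axis k 1) = H (axis i 1) (axis j 1) (axis k 1)"
  shows "G x y z = H x y z"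
proof -
  have "two_form (\<lambda>u v w. G u v w - H u v w)"
    using assms(1,2) by (auto simp: two_form_def intro: linear_compose_sub)
  from two_form_eq_0[OF this] assms(3) show ?thesis by simp
qed

section \<open>The standard form, and the system as an equation between forms\<close>

definition std_form :: "'v::real_inner \<Rightarrow> 'v \<Rightarrow> 'v \<Rightarrow> real" where
  "std_form u v w = (u \<bullet> v) * (w \<bullet> w) - (u \<bullet> w) * (v \<bullet> w)"

lemma g_st_std_form: "g_st p u v w = std_form (components u) (components v) (components w)"
  by (simp add: g_st_def std_form_def Let_def)

lemma two_form_std_form:
  assumes "linear A" shows "two_form (\<lambda>u v w. std_form (A u) (A v) (A w))"
proof -
  have "std_form u v u = 0" for u v :: 'b
    by (simp add: std_form_def inner_commute)
  then show ?thesis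
    by (auto simp: two_form_def std_form_def linear_iff linear_add[OF assms] linear_cmul[OF assms]
        inner_add_left inner_commute algebra_simps)
qed

text \<open>The Binet-Cauchy identity: for the columns u, v, w with indices \<open>i\<close>,
  \<open>j\<close>, \<open>k\<close> of the Jacobian matrix, the minors are the coordinates of the
  exterior products of u with w and of v with w, and the inner product of these is
  \<open>std_form u v w\<close>.\<close>

lemma sum_minors_eq_std_form:
  fixes f :: "real^3 \<Rightarrow> real^3"
  assumes "f differentiable (at q)"
  shows "(\<Sum>(\<alpha>, \<beta>)\<in>{(1::3, 2::3), (1, 3), (2, 3)}.
             jacobian_minor (\<lambda>x. f x $ \<alpha>) (\<lambda>x. f x $ \<beta>) i k q *
             jacobian_minor (\<lambda>x. f x $ \<alpha>) (\<lambda>x. f x $ \<beta>) j k q)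
    = std_form (frechet_derivative f (at q) (axis i 1)) (frechet_derivative f (at q) (axis j 1))
        (frechet_derivative f (at q) (axis k 1))"
  by (simp add: jacobian_minor_def partial_deriv_def frechet_derivative_vec_nth[OF assms]
      std_form_def inner_vec_def sum_3 algebra_simps)

text \<open>The axioms of \<open>g\<close> speak about \<open>V\<close> only. Pulling back along
  \<open>T\<close> gives a form on a whole vector space, where forms can be subtracted and
  compared.\<close>

lemma two_inner_product_two_form:
  assumes g: "two_inner_product V g" and T: "linear T" "range T \<subseteq> V"
  shows "two_form (\<lambda>u v w. g (T u) (T v) (T w))"
proof -
  have TV: "T u \<in> V" for u using T by auto
  note g' = g[unfolded two_inner_product_def]
  have lin: "g (a *\<^sub>R T u + T u') (T v) (T w) = a * g (T u) (T v) (T w) + g (T u') (T v) (T w)" for a u u' v w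
    using g' TV by simp
  \<comment> \<open>Coefficients 1 and -1. Definiteness then gives the value 0 at three equal
    arguments, which \<open>two_formI\<close> asks for.\<close>
  have ld: "lin_dep (T u) (T u)" for u
    unfolding lin_dep_def by (rule exI[of _ 1], rule exI[of _ "-1"]) simp
  show ?thesis
  proof (rule two_formI)
    fix u v w
    have add: "g (T (u + u')) (T v) (T w) = g (T u) (T v) (T w) + g (T u') (T v) (T w)" for u u'
      using lin[of 1 u u' v w] by (simp add: linear_add[OF T(1)])
    then have "g (T 0) (T v) (T w) = 0" using add[of 0 0] by simp
    then have "g (T (a *\<^sub>R u)) (T v) (T w) = a * g (T u) (T v) (T w)" for a u
      using lin[of a u 0 v w] by (simp add: linear_cmul[OF T(1)] linear_0[OF T(1)])
    with add show "linear (\<lambda>u. g (T u) (T v) (T w))" by (simp add: linear_iff)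
    show "g (T u) (T v) (T w) = g (T v) (T u) (T w)" using g' TV by simp
    show "g (T u) (T u) (T v) = g (T v) (T v) (T u)" using g' TV by simp
    show "g (T u) (T u) (T v) \<ge> 0" using g' TV by simp
    show "g (T u) (T u) (T u) = 0" using g' TV ld by simp
  qed
qed

text \<open>A kernel vector \<open>x\<close> of \<open>A\<close> makes the form vanish on
  \<open>x\<close> paired with any second vector, so definiteness makes their images under
  \<open>T\<close> dependent. A basis vector \<open>axis j 1\<close> with \<open>j\<close> different
  from a nonzero coordinate \<open>i\<close> of \<open>x\<close> is independent of \<open>x\<close>,
  a contradiction.\<close>

lemma inj_if_two_inner_product_eq:
  fixes T :: "real^3 \<Rightarrow> 'v::real_vector" and A :: "real^3 \<Rightarrow> real^3"
  assumes g: "two_inner_product V g" and T: "linear T" "range T \<subseteq> V" "inj T" and A: "linear A"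
    and eq: "\<And>u v w. g (T u) (T v) (T w) = std_form (A u) (A v) (A w)"
  shows "inj A"
  unfolding linear_injective_0[OF A]
proof (intro allI impI, rule ccontr)
  fix x assume "A x = 0" "x \<noteq> 0"
  then obtain i where i: "x $ i \<noteq> 0" by (auto simp: vec_eq_iff)
  obtain j :: 3 where j: "j \<noteq> i" using ex_third_3 by blast
  let ?y = "axis j 1 :: real^3"
  have "g (T x) (T x) (T ?y) = 0" unfolding eq by (simp add: \<open>A x = 0\<close> std_form_def)
  moreover have "T x \<in> V" "T ?y \<in> V" using T(2) by auto
  ultimately have "lin_dep (T x) (T ?y)"
    using g[unfolded two_inner_product_def] by simp
  then obtain a b where ab: "a \<noteq> 0 \<or> b \<noteq> 0" "a *\<^sub>R T x + b *\<^sub>R T ?y = 0"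
    unfolding lin_dep_def by blast
  then have "T (a *\<^sub>R x + b *\<^sub>R ?y) = T 0"
    by (simp add: linear_add[OF T(1)] linear_cmul[OF T(1)] linear_0[OF T(1)])
  then have "a *\<^sub>R x + b *\<^sub>R ?y = 0" using T(3) by (simp add: inj_eq)
  then have "(a *\<^sub>R x + b *\<^sub>R ?y) $ m = 0" for m by simp
  from this[of i] this[of j] ab(1) i j show False by (simp add: axis_def)
qed

section \<open>Local flatness and solvability of the system\<close>

lemma coordinate_systemE:
  assumes "smooth_manifold M" "coordinate_system M p0 D \<phi>"
  obtains W k where "coordinates M D W \<phi> k" "p0 \<in> W"
proof -
  obtain W where W: "open D" "openin (mtop M) W" "p0 \<in> W"
    "diffeomorphism (open_sub euclid D) (open_sub M W) \<phi>"
    using assms(2) unfolding coordinate_system_def by blast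
  have D: "openin (mtop euclid) D" using W(1) by simp
  obtain k where "smooth_map (open_sub euclid D) (open_sub M W) \<phi>" "smooth_map (open_sub M W) (open_sub euclid D) k"
    "\<forall>q\<in>D. k (\<phi> q) = q" "\<forall>p\<in>W. \<phi> (k p) = p"
    using W(4) unfolding diffeomorphism_def topspace_open_sub[OF W(2)] topspace_open_sub[OF D] by blast
  then have "coordinates M D W \<phi> k"
    using assms(1) W(1,2) by (simp add: coordinates_def)
  then show ?thesis using that W(3) by simp
qed

theorem theorem2p5:
  fixes M :: "('a, 3) mfd" and g :: "'a two_metric"
  assumes "two_riemannian_manifold M g"
  shows "locally_flat M g \<longleftrightarrow>
    (\<forall>p0\<in>topspace (mtop M). \<exists>D \<phi>. coordinate_system M p0 D \<phi> \<and>
      (\<exists>f :: real^3 \<Rightarrow> real^3. smooth_on D f \<and>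
        (\<forall>q\<in>D. \<forall>i j k :: 3.
          (\<Sum>(\<alpha>, \<beta>)\<in>{(1::3, 2::3), (1, 3), (2, 3)}.
             jacobian_minor (\<lambda>x. f x $ \<alpha>) (\<lambda>x. f x $ \<beta>) i k q *
             jacobian_minor (\<lambda>x. f x $ \<alpha>) (\<lambda>x. f x $ \<beta>) j k q)
          = metric_coeff M g \<phi> i j k q)))"
    (is "_ \<longleftrightarrow> (\<forall>p0\<in>_. \<exists>D \<phi>. _ \<and> (\<exists>f. _ \<and> ?pde D \<phi> f))")
proof
  have M: "smooth_manifold M" using assms by (simp add: two_riemannian_manifold_def)
  have pde: "?pde D \<phi> f \<longleftrightarrow> (\<forall>q\<in>D. \<forall>i j k. std_form (frechet_derivative f (at q) (axis i 1))
      (frechet_derivative f (at q) (axis j 1)) (frechet_derivative f (at q) (axis k 1))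
      = metric_coeff M g \<phi> i j k q)" if "smooth_on D f" for D \<phi> f
    by (intro ball_cong refl all_cong1 arg_cong2[where f = "(=)"] sum_minors_eq_std_form
        smooth_on_imp_differentiable[OF that])
  {
    assume flat: "locally_flat M g"
    show "\<forall>p0\<in>topspace (mtop M). \<exists>D \<phi>. coordinate_system M p0 D \<phi> \<and> (\<exists>f. smooth_on D f \<and> ?pde D \<phi> f)"
    proof
      fix p0 assume "p0 \<in> topspace (mtop M)"
      then obtain U V h where U: "openin (mtop M) U" "p0 \<in> U" and V': "openin (mtop (euclid :: (real^3, 3) mfd)) V"
        and iso: "two_isometry (open_sub M U) g (open_sub euclid V) g_st h"
        using flat unfolding locally_flat_def locally_two_isometric_def by blast
      have V: "open V" using V' by simp
      obtain \<phi> where h: "smooth_map (open_sub M U) (open_sub euclid V) h"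
        and \<phi>: "smooth_map (open_sub euclid V) (open_sub M U) \<phi>"
        and inv: "\<And>p. p \<in> U \<Longrightarrow> \<phi> (h p) = p" "\<And>q. q \<in> V \<Longrightarrow> h (\<phi> q) = q"
        using iso unfolding two_isometry_def diffeomorphism_def
          topspace_open_sub[OF U(1)] topspace_open_sub[OF V'] by (elim conjE exE) simp
      interpret coordinates M V U \<phi> h
        using M V U(1) \<phi> h inv by unfold_locales
      have "coordinate_system M p0 V \<phi>"
        unfolding coordinate_system_def diffeomorphism_def
        using V U \<phi> h inv by (intro conjI exI[of _ U] exI[of _ h]) (auto simp: topspace_open_sub)
      moreover have "?pde V \<phi> (\<lambda>x. x)"
        unfolding pde[OF smooth_on_ident]
      proof (intro ballI allI)
        fix q i j l assume q: "q \<in> V"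
        have p: "\<phi> q \<in> topspace (mtop (open_sub M U))"
          using \<phi>_in[OF q] by (simp add: topspace_open_sub[OF U(1)])
        have T: "tvec M \<phi> q a \<in> tangent_space (open_sub M U) (\<phi> q)" for a
          using tangent_space_eq[OF q] by (simp add: tangent_space_open_sub[OF M U(1) \<phi>_in[OF q]])
        \<comment> \<open>The differential of \<open>h\<close> takes the coordinate vectors of
          \<open>\<phi>\<close> back to the standard basis, so the isometry condition on three of
          them is the system for the identity.\<close>
        have "metric_coeff M g \<phi> i j l q = std_form (axis i 1) (axis j 1) (axis l (1::real))"
          using iso[unfolded two_isometry_def, THEN conjunct2, rule_format, OF p
              T[of "axis i 1"] T[of "axis j 1"] T[of "axis l 1"], symmetric]
          by (simp add: g_st_std_form metric_coeff_eq[OF q] components_differential_inverse[OF q])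
        then show "std_form (frechet_derivative (\<lambda>x. x) (at q) (axis i 1))
            (frechet_derivative (\<lambda>x. x) (at q) (axis j 1)) (frechet_derivative (\<lambda>x. x) (at q) (axis l 1))
          = metric_coeff M g \<phi> i j l q" by simp
      qed
      ultimately show "\<exists>D \<phi>. coordinate_system M p0 D \<phi> \<and> (\<exists>f. smooth_on D f \<and> ?pde D \<phi> f)"
        using smooth_on_ident by blast
    qed
  next
    assume R: "\<forall>p0\<in>topspace (mtop M). \<exists>D \<phi>. coordinate_system M p0 D \<phi> \<and> (\<exists>f. smooth_on D f \<and> ?pde D \<phi> f)"
    show "locally_flat M g"
      unfolding locally_flat_def locally_two_isometric_def
    proof
      fix p0 assume p0: "p0 \<in> topspace (mtop M)"
      with R obtain D \<phi> f where cs: "coordinate_system M p0 D \<phi>" and f: "smooth_on D f" and "?pde D \<phi> f"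
        by blast
      note P = \<open>?pde D \<phi> f\<close>[unfolded pde[OF f], rule_format]
      obtain W k where "coordinates M D W \<phi> k" and p0W: "p0 \<in> W"
        using coordinate_systemE[OF M cs] by blast
      then interpret coordinates M D W \<phi> k by simp
      have tip: "two_inner_product (tangent_space M (\<phi> q)) (g (\<phi> q))" if "q \<in> D" for q
        using assms \<phi>_in[OF that] openin_subset[OF W]
        by (auto simp: two_riemannian_manifold_def two_riemannian_metric_def)
      have ran: "range (tvec M \<phi> q) \<subseteq> tangent_space M (\<phi> q)" if "q \<in> D" for q
        by (simp add: tangent_space_eq that)
      have linf: "linear (frechet_derivative f (at q))" if "q \<in> D" for q
        by (rule linear_frechet_derivative[OF smooth_on_imp_differentiable[OF f that]])
      \<comment> \<open>Both sides are forms on \<open>real^3\<close>, the pull-backs of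
        \<open>g\<close> by the differential of \<open>\<phi>\<close> and of the standard form by
        that of \<open>f\<close>; the system is their equality on basis triples.\<close>
      have key: "g (\<phi> q) (tvec M \<phi> q x) (tvec M \<phi> q y) (tvec M \<phi> q z)
          = std_form (frechet_derivative f (at q) x) (frechet_derivative f (at q) y)
              (frechet_derivative f (at q) z)" if q: "q \<in> D" for q x y z
        by (rule two_form_eqI[OF two_inner_product_two_form[OF tip[OF q] linear_tvec[OF q] ran[OF q]]
              two_form_std_form[OF linf[OF q]]])
           (simp add: P[OF q] metric_coeff_eq[OF q])
      note q0 = k_in[OF p0W]
      have "inj (frechet_derivative f (at (k p0)))"
        by (rule inj_if_two_inner_product_eq[where g = "g (\<phi> (k p0))" and T = "tvec M \<phi> (k p0)"])
           (rule tip[OF q0] linear_tvec[OF q0] ran[OF q0] inj_tvec[OF q0] linf[OF q0] key[OF q0])+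
      from smooth_inverse_function[OF D f q0 this]
      obtain D' V fi where D': "open D'" "D' \<subseteq> D" "k p0 \<in> D'" and V: "open V"
        and hom: "homeomorphism D' V f fi" and fi: "smooth_on V fi" by blast
      \<comment> \<open>\<open>f\<close> is invertible only near \<open>k p0\<close>, so the
        coordinates are cut down to \<open>D'\<close> before \<open>h\<close> is formed.\<close>
      define U where "U = \<phi> ` D'"
      define h where "h = f \<circ> k"
      interpret r: coordinates M D' U \<phi> k
        unfolding U_def by (rule restrict[OF D'(1,2)])
      have V': "openin (mtop (euclid :: (real^3, 3) mfd)) V" using V by simp
      note EV = smooth_manifold_open_sub[OF smooth_manifold_euclid V']
      have h: "smooth_map (open_sub M U) (open_sub euclid V) h"
        unfolding h_def
        by (rule smooth_map_compose[OF r.MW r.ED EV r.k])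
           (use smooth_on_subset[OF f D'(2)] hom in \<open>auto simp: smooth_map_euclid D' V homeomorphism_def\<close>)
      have h': "smooth_map (open_sub euclid V) (open_sub M U) (\<phi> \<circ> fi)"
        by (rule smooth_map_compose[OF EV r.ED r.MW _ r.\<phi>])
           (use fi hom in \<open>auto simp: smooth_map_euclid D' V homeomorphism_def\<close>)
      have "two_isometry (open_sub M U) g (open_sub euclid V) g_st h"
        unfolding two_isometry_def diffeomorphism_def
          topspace_open_sub[OF r.W] topspace_open_sub[OF V']
      proof (intro conjI exI[of _ "\<phi> \<circ> fi"] h h' ballI)
        show "(\<phi> \<circ> fi) (h p) = p" if "p \<in> U" for p
          using that hom r.k_in[OF that] r.\<phi>k by (simp add: h_def homeomorphism_def)
        show "h ((\<phi> \<circ> fi) q) = q" if "q \<in> V" for q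
          using that hom r.k\<phi> by (auto simp: h_def homeomorphism_def)
        fix p u v w assume p: "p \<in> U" and uvw: "u \<in> tangent_space (open_sub M U) p"
          "v \<in> tangent_space (open_sub M U) p" "w \<in> tangent_space (open_sub M U) p"
        define q where "q = k p"
        have q: "q \<in> D'" "q \<in> D" "\<phi> q = p" using r.k_in[OF p] r.\<phi>k[OF p] D'(2) by (auto simp: q_def)
        have "\<exists>x. u = tvec M \<phi> q x" if "u \<in> tangent_space (open_sub M U) p" for u
          using that r.tangent_space_eq[OF q(1)]
          by (auto simp: q(3) tangent_space_open_sub[OF M r.W p])
        then obtain x y z where xyz: "u = tvec M \<phi> q x" "v = tvec M \<phi> q y" "w = tvec M \<phi> q z"
          using uvw by metis
        \<comment> \<open>In the coordinates \<open>\<phi>\<close> the map \<open>h\<close> is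
          \<open>f\<close> itself on \<open>D'\<close>, so its differential acts on components as
          the derivative of \<open>f\<close>, and the isometry equation becomes
          \<open>key\<close>.\<close>
        have "(f has_derivative frechet_derivative f (at q)) (at q)"
          by (rule smooth_on_has_derivative[OF f q(2)])
        then have "((h \<circ> \<phi>) has_derivative frechet_derivative f (at q)) (at q)"
          by (rule has_derivative_transform_within_open[OF _ D'(1) q(1)]) (simp add: h_def r.k\<phi>)
        then have der: "h \<circ> \<phi> differentiable (at q)"
          "frechet_derivative (h \<circ> \<phi>) (at q) = frechet_derivative f (at q)"
          by (auto simp: differentiable_def simp flip: frechet_derivative_at)
        have hV: "(h \<circ> \<phi>) q \<in> V" using q(1) hom by (auto simp: h_def r.k\<phi> homeomorphism_def)
        have "components (differential (open_sub euclid V) h p (tvec M \<phi> q a)) = frechet_derivative f (at q) a" for a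
          using differential_tvec[where \<phi> = \<phi>, OF M r.W r.\<phi>_in[OF q(1)] EV h]
            components_tvec[OF V hV der(1)] by (simp add: q(3) der(2))
        then show "g_st (h p) (differential (open_sub euclid V) h p u)
            (differential (open_sub euclid V) h p v) (differential (open_sub euclid V) h p w) = g p u v w"
          using key[OF q(2)] by (simp add: g_st_std_form xyz q(3))
      qed
      moreover have "p0 \<in> U" unfolding U_def using D'(3) \<phi>k[OF p0W] by (metis image_eqI)
      ultimately show "\<exists>U V. openin (mtop M) U \<and> p0 \<in> U \<and> openin (mtop (euclid :: (real^3, 3) mfd)) V \<and>
          (\<exists>h. two_isometry (open_sub M U) g (open_sub euclid V) g_st h)"
        using r.W V' by blast
    qed
  }
qed

end
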